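(* Let $I=[a,b]$, let $f=f(\cdot\,;r):I\to I$ be a member of a one-parameter family of unimodal functions with negative Schwarzian derivative and critical point $C$ (a maximum), and let $O_p=\{S_i\}_{i=1}^p$ be a stable $p$-periodic orbit of the system $x_{n+1}=f(x_n;r)$. Let $I_P=\bigcup_{i=1}^p I_{P_i}$ be the capture interval of $O_p$ and, for a positive integer $q$, let $W_R=\bigcup_{i,j}W_{q_{ij}}$ be the $q$-capture interval of $O_p$ (both defined in the context). Let $\mu$ denote Lebesgue measure. If a point $x$ is chosen uniformly at random from $I$, then the probability $P_q$ that $x$ reaches a capture interval of $O_p$ after at most $q$ iterations (i.e., that $f^l(x)\in I_P$ for some integer $0\le l\le q$) is $$P_q=\frac{\mu(W_R)}{\mu(I)}=\frac{\mu(W_R)}{b-a}.$$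
   Context: Setting. $f(x;r)$ is a one-parameter family of unimodal functions $f:I\to I$, $I=[a,b]$, with negative Schwarzian derivative, with a single critical point $C$, at which $f$ has its (local and global) maximum. $f^n$ denotes the $n$-th iterate. The stable $p$-periodic orbit $\{S_i\}_{i=1}^p$ and the points $U_i$. The stable orbit arises, as $r$ is varied, either (1) from $p$ simultaneous saddle-node bifurcations of $f^p$, each of which creates a stable fixed point $S_i$ of $f^p$ (node) and an unstable fixed point $U_i$ of $f^p$ (saddle); or (2) from a period-doubling bifurcation, in which a previously stable periodic orbit becomes unstable and stable points appear on both sides of each of its points; then $U_i$ is the point of the now unstable orbit from which $S_i$ bifurcated. In both cases $f^p(S_i)=S_i$, $f^p(U_i)=U_i$, and $U_i$ is the nearest unstable fixed point of $f^p$ to $S_i$. In a neighborhood of $S_i$ the graph of $f^p$ is concave or convex. Capture interval. Let $x_i=U_i$ (the abscissa of the point of the graph of $f^p$ at $U_i$), and let $x_i'$ be the abscissa of the point nearest to $S_i$, on the other side of $S_i$ from $U_i$, at which the horizontal line of height $U_i$ meets the graph of $f^p$; thus $f^p(x_i')=U_i$. The $i$th capture interval is $I_{P_i}=(x_i,x_i')$ if $f^p$ is concave near $S_i$ and $I_{P_i}=(x_i',x_i)$ if $f^p$ is convex near $S_i$. The (aggregate) capture interval of the orbit is $I_P=\bigcup_i I_{P_i}$. Intervals of monotonicity. Let $q_2<\dots<q_{k-1}$ be the points at which $f^q$ has extrema, and put $q_1=a$, $q_k=b$. The $j$th interval of monotonicity of $f^q$ is $I_{q_j}=[q_j,q_{j+1}]$,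 $j=1,\dots,k-1$; $f^q$ is monotonic on each. $q$-capture interval. $W_{q_{ij}}$ is the (possibly empty) subinterval of $I_{q_j}$ that is mapped by $f^q$ into $I_{P_i}$, i.e. $W_{q_{ij}}=\{x\in I_{q_j}: f^q(x)\in I_{P_i}\}$. Thus, if $I_{q_j}$ contains points $x_{i,q_j},x_{i,q_j}'$ with $f^q(x_{i,q_j})=x_i$ and $f^q(x_{i,q_j}')=x_i'$, then $W_{q_{ij}}$ is the open interval between them; if it is cut off by an extremum of $f^q$, it is the interval from the one existing preimage point up to and including that extremum. The $q$-capture interval of the orbit is $W_R=\bigcup_{i,j}W_{q_{ij}}$. *)

theory Defs
  imports "HOL-Probability.Probability"
begin

definition schwarzian :: "(real \<Rightarrow> real) \<Rightarrow> real \<Rightarrow> real" where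
  "schwarzian f x =
     (deriv ^^ 3) f x / deriv f x - 3 / 2 * ((deriv ^^ 2) f x / deriv f x)\<^sup>2"

text \<open>
  Only the values of \<open>f\<close> on \<open>{a..b}\<close> matter; derivatives are taken at interior points, so the
  behaviour of \<open>f\<close> outside the interval is irrelevant. The Schwarzian derivative is not defined
  at the critical point \<open>c\<close>.
\<close>
definition unimodal_neg_schwarzian :: "real \<Rightarrow> real \<Rightarrow> real \<Rightarrow> (real \<Rightarrow> real) \<Rightarrow> bool" where
  "unimodal_neg_schwarzian a b c f \<longleftrightarrow>
     c \<in> {a<..<b} \<and>
     f \<in> {a..b} \<rightarrow> {a..b} \<and>
     continuous_on {a..b} f \<and>
     strict_mono_on {a..c} f \<and> strict_antimono_on {c..b} f \<and>
     (\<forall>x\<in>{a<..<b}. \<forall>k<3. (deriv ^^ k) f field_differentiable (at x)) \<and>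
     (\<forall>x\<in>{a<..<b}. deriv f x = 0 \<longleftrightarrow> x = c) \<and>
     (\<forall>x\<in>{a<..<b} - {c}. schwarzian f x < 0)"

definition lyapunov_stable :: "real set \<Rightarrow> (real \<Rightarrow> real) \<Rightarrow> real \<Rightarrow> bool" where
  "lyapunov_stable I g z \<longleftrightarrow>
     (\<forall>e>0. \<exists>d>0. \<forall>x\<in>I. dist x z < d \<longrightarrow> (\<forall>n. dist ((g ^^ n) x) z < e))"

text \<open>Here stable means asymptotically stable; unstable means not Lyapunov stable.\<close>
definition stable_fixed_point :: "real set \<Rightarrow> (real \<Rightarrow> real) \<Rightarrow> real \<Rightarrow> bool" where
  "stable_fixed_point I g z \<longleftrightarrow>
     z \<in> I \<and> g z = z \<and> lyapunov_stable I g z \<and>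
     (\<exists>d>0. \<forall>x\<in>I. dist x z < d \<longrightarrow> (\<lambda>n. (g ^^ n) x) \<longlonglongrightarrow> z)"

definition unstable_fixed_point :: "real set \<Rightarrow> (real \<Rightarrow> real) \<Rightarrow> real \<Rightarrow> bool" where
  "unstable_fixed_point I g z \<longleftrightarrow> z \<in> I \<and> g z = z \<and> \<not> lyapunov_stable I g z"

text \<open>The points of a \<open>p\<close>-periodic orbit are indexed by \<open>{..<p}\<close> in dynamical order.\<close>
definition periodic_orbit :: "real set \<Rightarrow> (real \<Rightarrow> real) \<Rightarrow> nat \<Rightarrow> (nat \<Rightarrow> real) \<Rightarrow> bool" where
  "periodic_orbit I f p S \<longleftrightarrow>
     p > 0 \<and> inj_on S {..<p} \<and> (\<forall>i<p. S i \<in> I \<and> f (S i) = S (Suc i mod p))"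

definition stable_periodic_orbit :: "real set \<Rightarrow> (real \<Rightarrow> real) \<Rightarrow> nat \<Rightarrow> (nat \<Rightarrow> real) \<Rightarrow> bool" where
  "stable_periodic_orbit I f p S \<longleftrightarrow>
     periodic_orbit I f p S \<and> (\<forall>i<p. stable_fixed_point I (f ^^ p) (S i))"

definition unstable_periodic_orbit :: "real set \<Rightarrow> (real \<Rightarrow> real) \<Rightarrow> nat \<Rightarrow> (nat \<Rightarrow> real) \<Rightarrow> bool" where
  "unstable_periodic_orbit I f p S \<longleftrightarrow>
     periodic_orbit I f p S \<and> (\<forall>i<p. unstable_fixed_point I (f ^^ p) (S i))"

text \<open>
  The two ways in which the orbit \<open>S\<close> of \<open>f r\<close> and the points \<open>U i\<close> arise from a bifurcation
  value \<open>r0\<close>. The functions \<open>\<sigma> i\<close> and \<open>\<upsilon> i\<close> are the continuations of \<open>S i\<close> and \<open>U i\<close>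
  along the parameter segment from \<open>r\<close> back to \<open>r0\<close>, where they coalesce. At a saddle-node,
  \<open>f s ^^ p\<close> has locally no fixed point for \<open>s\<close> before \<open>r0\<close>, one at \<open>r0\<close>, and exactly the
  node \<open>\<sigma> i s\<close> and the saddle \<open>\<upsilon> i s\<close> after \<open>r0\<close>; before and after refer to the
  side of \<open>r0\<close> not containing, respectively containing, \<open>r\<close>.
\<close>
definition saddle_node_origin ::
  "real set \<Rightarrow> (real \<Rightarrow> real \<Rightarrow> real) \<Rightarrow> real set \<Rightarrow> real \<Rightarrow> nat \<Rightarrow> (nat \<Rightarrow> real) \<Rightarrow> (nat \<Rightarrow> real) \<Rightarrow> bool" where
  "saddle_node_origin I f R r p S U \<longleftrightarrow>
     (\<exists>r0 \<sigma> \<upsilon>. r0 \<in> interior R \<and> r0 \<noteq> r \<and> closed_segment r0 r \<subseteq> R \<and>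
       (\<forall>i<p. continuous_on (closed_segment r0 r) (\<sigma> i) \<and>
              continuous_on (closed_segment r0 r) (\<upsilon> i) \<and>
              \<sigma> i r = S i \<and> \<upsilon> i r = U i \<and> \<sigma> i r0 = \<upsilon> i r0) \<and>
       (\<forall>s\<in>closed_segment r0 r - {r0}.
          stable_periodic_orbit I (f s) p (\<lambda>i. \<sigma> i s) \<and>
          (\<forall>i<p. unstable_fixed_point I (f s ^^ p) (\<upsilon> i s))) \<and>
       (\<exists>e>0. \<exists>d>0. \<forall>i<p. \<forall>s\<in>ball r0 d.
          {x \<in> I \<inter> ball (\<sigma> i r0) e. (f s ^^ p) x = x} =
            (if (s - r0) * (r - r0) < 0 then {}
             else if s = r0 then {\<sigma> i r0}
             else {\<sigma> i s, \<upsilon> i s})))"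

text \<open>
  At a period doubling the orbit \<open>\<upsilon>\<close> has period \<open>m\<close> with \<open>p = 2 * m\<close>; the points \<open>S i\<close> and
  \<open>S (i + m)\<close> bifurcate from the same point \<open>U i = U (i + m)\<close>, to opposite sides of it.
\<close>
definition period_doubling_origin ::
  "real set \<Rightarrow> (real \<Rightarrow> real \<Rightarrow> real) \<Rightarrow> real set \<Rightarrow> real \<Rightarrow> nat \<Rightarrow> (nat \<Rightarrow> real) \<Rightarrow> (nat \<Rightarrow> real) \<Rightarrow> bool" where
  "period_doubling_origin I f R r p S U \<longleftrightarrow>
     (\<exists>m r0 \<sigma> \<upsilon>. p = 2 * m \<and> r0 \<in> interior R \<and> r0 \<noteq> r \<and> closed_segment r0 r \<subseteq> R \<and>
       (\<forall>i<p. continuous_on (closed_segment r0 r) (\<sigma> i) \<and>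
              \<sigma> i r = S i \<and> \<upsilon> (i mod m) r = U i \<and> \<sigma> i r0 = \<upsilon> (i mod m) r0) \<and>
       (\<forall>s\<in>closed_segment r0 r - {r0}.
          stable_periodic_orbit I (f s) p (\<lambda>i. \<sigma> i s) \<and>
          unstable_periodic_orbit I (f s) m (\<lambda>i. \<upsilon> i s) \<and>
          (\<forall>i<m. \<upsilon> i s \<in> open_segment (\<sigma> i s) (\<sigma> (i + m) s))) \<and>
       (\<exists>d>0. ball r0 d \<subseteq> R \<and>
          (\<forall>i<m. continuous_on (ball r0 d \<union> closed_segment r0 r) (\<upsilon> i)) \<and>
          (\<forall>s\<in>ball r0 d. (s - r0) * (r - r0) < 0 \<longrightarrow>
             stable_periodic_orbit I (f s) m (\<lambda>i. \<upsilon> i s))))"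

definition nearest_unstable_fixed_point :: "real set \<Rightarrow> (real \<Rightarrow> real) \<Rightarrow> real \<Rightarrow> real \<Rightarrow> bool" where
  "nearest_unstable_fixed_point I g s u \<longleftrightarrow>
     unstable_fixed_point I g u \<and>
     (\<forall>z. unstable_fixed_point I g z \<longrightarrow> dist u s \<le> dist z s)"

definition concave_near :: "real set \<Rightarrow> (real \<Rightarrow> real) \<Rightarrow> real \<Rightarrow> bool" where
  "concave_near I g s \<longleftrightarrow> (\<exists>e>0. concave_on (I \<inter> ball s e) g)"

definition convex_near :: "real set \<Rightarrow> (real \<Rightarrow> real) \<Rightarrow> real \<Rightarrow> bool" where
  "convex_near I g s \<longleftrightarrow> (\<exists>e>0. convex_on (I \<inter> ball s e) g)"

text \<open>
  \<open>x'\<close> is the abscissa nearest to \<open>s\<close>, on the other side of \<open>s\<close> from \<open>u\<close>, at which the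
  horizontal line of height \<open>u\<close> meets the graph of \<open>g\<close>.
\<close>
definition opposite_point :: "real set \<Rightarrow> (real \<Rightarrow> real) \<Rightarrow> real \<Rightarrow> real \<Rightarrow> real \<Rightarrow> bool" where
  "opposite_point I g s u x' \<longleftrightarrow>
     x' \<in> I \<and> s \<in> open_segment u x' \<and> g x' = u \<and>
     (\<forall>y\<in>I. s \<in> open_segment u y \<and> g y = u \<longrightarrow> dist x' s \<le> dist y s)"

definition capture_interval_at ::
  "real set \<Rightarrow> (real \<Rightarrow> real) \<Rightarrow> nat \<Rightarrow> (nat \<Rightarrow> real) \<Rightarrow> (nat \<Rightarrow> real) \<Rightarrow> (nat \<Rightarrow> real) \<Rightarrow> nat \<Rightarrow> real set" where
  "capture_interval_at I f p S U X' i =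
     (if concave_near I (f ^^ p) (S i) then {U i<..<X' i} else {X' i<..<U i})"

definition capture_interval ::
  "real set \<Rightarrow> (real \<Rightarrow> real) \<Rightarrow> nat \<Rightarrow> (nat \<Rightarrow> real) \<Rightarrow> (nat \<Rightarrow> real) \<Rightarrow> (nat \<Rightarrow> real) \<Rightarrow> real set" where
  "capture_interval I f p S U X' = (\<Union>i<p. capture_interval_at I f p S U X' i)"

definition extremum_points :: "real \<Rightarrow> real \<Rightarrow> (real \<Rightarrow> real) \<Rightarrow> real set" where
  "extremum_points a b g =
     {x \<in> {a<..<b}. (\<forall>\<^sub>F y in at x. g y \<le> g x) \<or> (\<forall>\<^sub>F y in at x. g x \<le> g y)}"

text \<open>
  The increasing list of the endpoints and the interior extrema (a finite set when \<open>g\<close> is an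
  iterate of a unimodal map as above). List positions start at 0.
\<close>
definition partition_points :: "real \<Rightarrow> real \<Rightarrow> (real \<Rightarrow> real) \<Rightarrow> real list" where
  "partition_points a b g = sorted_list_of_set ({a, b} \<union> extremum_points a b g)"

definition monotonicity_interval :: "real \<Rightarrow> real \<Rightarrow> (real \<Rightarrow> real) \<Rightarrow> nat \<Rightarrow> real set" where
  "monotonicity_interval a b g j =
     {partition_points a b g ! j .. partition_points a b g ! Suc j}"

definition q_capture_interval_at ::
  "real \<Rightarrow> real \<Rightarrow> (real \<Rightarrow> real) \<Rightarrow> nat \<Rightarrow> (nat \<Rightarrow> real) \<Rightarrow> (nat \<Rightarrow> real) \<Rightarrow> (nat \<Rightarrow> real) \<Rightarrow> nat
     \<Rightarrow> nat \<Rightarrow> nat \<Rightarrow> real set" where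
  "q_capture_interval_at a b f p S U X' q i j =
     {x \<in> monotonicity_interval a b (f ^^ q) j.
        (f ^^ q) x \<in> capture_interval_at {a..b} f p S U X' i}"

definition q_capture_interval ::
  "real \<Rightarrow> real \<Rightarrow> (real \<Rightarrow> real) \<Rightarrow> nat \<Rightarrow> (nat \<Rightarrow> real) \<Rightarrow> (nat \<Rightarrow> real) \<Rightarrow> (nat \<Rightarrow> real) \<Rightarrow> nat
     \<Rightarrow> real set" where
  "q_capture_interval a b f p S U X' q =
     (\<Union>i<p. \<Union>j<length (partition_points a b (f ^^ q)) - 1.
        q_capture_interval_at a b f p S U X' q i j)"

text \<open>The sample space is \<open>{a..b}\<close> itself, as the dynamics is only defined there.\<close>
definition uniform_on_interval :: "real \<Rightarrow> real \<Rightarrow> real measure" where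
  "uniform_on_interval a b = uniform_measure (restrict_space lborel {a..b}) {a..b}"

end

theory Submission
  imports Defs
begin

text \<open>
  Let \<open>g = f ^^ p\<close>. The capture interval at \<open>S i\<close> is the immediate basin \<open>B i\<close> of \<open>S i\<close> under \<open>g\<close>, the
  component of the basin of attraction containing \<open>S i\<close>. Since \<open>f\<close> maps \<open>B i\<close> into the next
  immediate basin, a point that has entered the capture interval never leaves it, so it is captured
  within \<open>q\<close> steps iff \<open>(f ^^ q) x\<close> lies in the capture interval. The partition into intervals of
  monotonicity covers \<open>{a..b}\<close> because the extrema of \<open>f ^^ q\<close> are preimages of the critical point.

  To identify \<open>B i = {al<..<be}\<close>, note that \<open>g\<close> maps \<open>{al, be}\<close> into itself. The
  sets \<open>B i\<close> are disjoint, so \<open>g\<close> has at most one turning point in \<open>B i\<close>, and the minimum principle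
  for \<open>\<bar>deriv g\<bar>\<close> given by the negative Schwarzian derivative leaves only \<open>g al = g be\<close>. The common
  value is a fixed point that is not Lyapunov stable. If it were the endpoint on the side of \<open>S i\<close>
  opposite to \<open>U i\<close>, concavity (convexity) near \<open>S i\<close> would place it no farther from \<open>S i\<close> than the
  other endpoint, against the choice of \<open>U i\<close> as nearest unstable fixed point. Hence it is \<open>U i\<close>, and
  the other endpoint is \<open>X' i\<close>.
\<close>

section \<open>Negative Schwarzian derivative\<close>

text \<open>
  The derivatives are existential witnesses instead of iterated \<open>deriv\<close>, which makes the
  condition easy to transport along compositions; the last inequality is the negativity of the
  Schwarzian derivative multiplied by \<open>2 * (h1 x)\<^sup>2\<close>.
\<close>
definition neg_schwarzian_on ::
  "(real \<Rightarrow> real) \<Rightarrow> (real \<Rightarrow> real) \<Rightarrow> real set \<Rightarrow> bool" where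
  "neg_schwarzian_on h h1 X \<longleftrightarrow>
     (\<exists>h2 h3. \<forall>x\<in>X.
        (h has_real_derivative h1 x) (at x) \<and> (h1 has_real_derivative h2 x) (at x) \<and>
        (h2 has_real_derivative h3 x) (at x) \<and> h1 x \<noteq> 0 \<and> 2 * h1 x * h3 x < 3 * (h2 x)\<^sup>2)"

section \<open>Permanence properties and the minimum principle\<close>

lemma neg_schwarzian_on_subset:
  "neg_schwarzian_on h h1 X \<Longrightarrow> Y \<subseteq> X \<Longrightarrow> neg_schwarzian_on h h1 Y"
  unfolding neg_schwarzian_on_def by blast

lemma neg_schwarzian_on_DERIV:
  "neg_schwarzian_on h h1 X \<Longrightarrow> x \<in> X \<Longrightarrow> (h has_real_derivative h1 x) (at x)"
  and neg_schwarzian_on_nonzero: "neg_schwarzian_on h h1 X \<Longrightarrow> x \<in> X \<Longrightarrow> h1 x \<noteq> 0"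
  unfolding neg_schwarzian_on_def by blast+

lemma neg_schwarzian_on_continuous:
  "neg_schwarzian_on h h1 X \<Longrightarrow> continuous_on X h1"
  unfolding neg_schwarzian_on_def
  by (metis DERIV_isCont continuous_at_imp_continuous_on)

text \<open>The chain rule S(f o g) = (Sf o g) * g'^2 + Sg for the Schwarzian derivative S is a sum
  of two negative terms. The step \<open>id\<close> is this rule cleared of denominators, each
  summand being a positive factor times a positive defect.\<close>

lemma neg_schwarzian_on_compose:
  assumes f: "neg_schwarzian_on f f1 Y" and g: "neg_schwarzian_on g g1 X" and sub: "g ` X \<subseteq> Y"
  shows "neg_schwarzian_on (\<lambda>x. f (g x)) (\<lambda>x. f1 (g x) * g1 x) X"
proof -
  obtain f2 f3 where F: "\<And>y. y \<in> Y \<Longrightarrow>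
        (f has_real_derivative f1 y) (at y) \<and> (f1 has_real_derivative f2 y) (at y) \<and>
        (f2 has_real_derivative f3 y) (at y) \<and> f1 y \<noteq> 0 \<and> 2 * f1 y * f3 y < 3 * (f2 y)\<^sup>2"
    using f unfolding neg_schwarzian_on_def by blast
  obtain g2 g3 where G: "\<And>y. y \<in> X \<Longrightarrow>
        (g has_real_derivative g1 y) (at y) \<and> (g1 has_real_derivative g2 y) (at y) \<and>
        (g2 has_real_derivative g3 y) (at y) \<and> g1 y \<noteq> 0 \<and> 2 * g1 y * g3 y < 3 * (g2 y)\<^sup>2"
    using g unfolding neg_schwarzian_on_def by blast
  let ?h2 = "\<lambda>x. f2 (g x) * (g1 x)\<^sup>2 + f1 (g x) * g2 x"
  let ?h3 = "\<lambda>x. f3 (g x) * (g1 x)^3 + 3 * f2 (g x) * g1 x * g2 x + f1 (g x) * g3 x"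
  have main: "((\<lambda>x. f (g x)) has_real_derivative f1 (g x) * g1 x) (at x) \<and>
        ((\<lambda>x. f1 (g x) * g1 x) has_real_derivative ?h2 x) (at x) \<and>
        (?h2 has_real_derivative ?h3 x) (at x) \<and> f1 (g x) * g1 x \<noteq> 0 \<and>
        2 * (f1 (g x) * g1 x) * ?h3 x < 3 * (?h2 x)\<^sup>2" if "x \<in> X" for x
  proof -
    from that sub have y: "g x \<in> Y" by blast
    note Fx = F[OF y] and Gx = G[OF that]
    have d0: "((\<lambda>x. f (g x)) has_real_derivative f1 (g x) * g1 x) (at x)"
      and d1: "((\<lambda>x. f1 (g x)) has_real_derivative f2 (g x) * g1 x) (at x)"
      and d2: "((\<lambda>x. f2 (g x)) has_real_derivative f3 (g x) * g1 x) (at x)"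
      using Fx Gx by (auto intro: DERIV_chain2)
    have e1: "((\<lambda>x. f1 (g x) * g1 x) has_real_derivative ?h2 x) (at x)"
      by (rule derivative_eq_intros d1 conjunct1[OF conjunct2[OF Gx]] refl)+
        (simp add: algebra_simps power2_eq_square)
    have e2: "(?h2 has_real_derivative ?h3 x) (at x)"
      by (rule derivative_eq_intros d1 d2 conjunct1[OF conjunct2[OF Gx]]
            conjunct1[OF conjunct2[OF conjunct2[OF Gx]]] refl)+
        (simp add: algebra_simps power2_eq_square power3_eq_cube)
    have nz: "f1 (g x) * g1 x \<noteq> 0" using Fx Gx by simp
    have id: "3 * (?h2 x)\<^sup>2 - 2 * (f1 (g x) * g1 x) * ?h3 x =
        (g1 x)^4 * (3 * (f2 (g x))\<^sup>2 - 2 * f1 (g x) * f3 (g x)) +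
        (f1 (g x))\<^sup>2 * (3 * (g2 x)\<^sup>2 - 2 * g1 x * g3 x)"
      by (simp add: algebra_simps power2_eq_square power3_eq_cube power4_eq_xxxx)
    have "(g1 x)^4 * (3 * (f2 (g x))\<^sup>2 - 2 * f1 (g x) * f3 (g x)) > 0"
      using Fx Gx by simp
    moreover have "(f1 (g x))\<^sup>2 * (3 * (g2 x)\<^sup>2 - 2 * g1 x * g3 x) > 0"
      using Fx Gx by simp
    ultimately have "3 * (?h2 x)\<^sup>2 - 2 * (f1 (g x) * g1 x) * ?h3 x > 0"
      unfolding id by linarith
    then show ?thesis using d0 e1 e2 nz by auto
  qed
  show ?thesis unfolding neg_schwarzian_on_def
    by (rule exI[of _ ?h2], rule exI[of _ ?h3], rule ballI, rule main)
qed

text \<open>Conjugation by x -> -x turns the graph through half a circle: the second derivative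
  changes sign, the first and third do not. It reduces the convex case to the concave one.\<close>

lemma neg_schwarzian_on_reflect:
  assumes "neg_schwarzian_on h h1 X"
  shows "neg_schwarzian_on (\<lambda>x. - h (- x)) (\<lambda>x. h1 (- x)) (uminus ` X)"
proof -
  obtain h2 h3 where H: "\<And>y. y \<in> X \<Longrightarrow>
        (h has_real_derivative h1 y) (at y) \<and> (h1 has_real_derivative h2 y) (at y) \<and>
        (h2 has_real_derivative h3 y) (at y) \<and> h1 y \<noteq> 0 \<and> 2 * h1 y * h3 y < 3 * (h2 y)\<^sup>2"
    using assms unfolding neg_schwarzian_on_def by blast
  have refl: "((\<lambda>x. k (- x)) has_real_derivative - D) (at (- y))"
    if "(k has_real_derivative D) (at y)" for k :: "real \<Rightarrow> real" and D y
    using that DERIV_mirror[of k D "- y"] by simp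
  have main: "((\<lambda>x. - h (- x)) has_real_derivative h1 (- x)) (at x) \<and>
        ((\<lambda>x. h1 (- x)) has_real_derivative - h2 (- x)) (at x) \<and>
        ((\<lambda>x. - h2 (- x)) has_real_derivative h3 (- x)) (at x) \<and> h1 (- x) \<noteq> 0 \<and>
        2 * h1 (- x) * h3 (- x) < 3 * (- h2 (- x))\<^sup>2" if "x \<in> uminus ` X" for x
  proof -
    from that obtain y where y: "y \<in> X" "x = - y" by blast
    note Hy = H[OF y(1)]
    show ?thesis
      using Hy refl[of h "h1 y" y] refl[of h1 "h2 y" y] refl[of h2 "h3 y" y]
        DERIV_minus[of "\<lambda>x. h (- x)" "- h1 y" "- y" UNIV]
        DERIV_minus[of "\<lambda>x. h2 (- x)" "- h3 y" "- y" UNIV]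
      unfolding y(2) by simp
  qed
  show ?thesis unfolding neg_schwarzian_on_def
    by (rule exI[of _ "\<lambda>x. - h2 (- x)"], rule exI[of _ "\<lambda>x. h3 (- x)"], rule ballI, rule main)
qed

text \<open>The square of \<open>h1\<close> would have an interior minimum, where \<open>h2\<close>
  vanishes and the Schwarzian inequality makes the second derivative of the square negative.
  Squaring removes the need to distinguish the sign of \<open>h1\<close>.\<close>

lemma minimum_principle:
  assumes ns: "neg_schwarzian_on h h1 X" and X: "{u..v} \<subseteq> X" and s: "u < s" "s < v"
    and le: "\<bar>h1 s\<bar> \<le> \<bar>h1 u\<bar>" "\<bar>h1 s\<bar> \<le> \<bar>h1 v\<bar>"
  shows False
proof -
  obtain h2 h3 where H: "\<And>y. y \<in> {u..v} \<Longrightarrow>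
        (h has_real_derivative h1 y) (at y) \<and> (h1 has_real_derivative h2 y) (at y) \<and>
        (h2 has_real_derivative h3 y) (at y) \<and> h1 y \<noteq> 0 \<and> 2 * h1 y * h3 y < 3 * (h2 y)\<^sup>2"
    using ns X unfolding neg_schwarzian_on_def by blast
  define k where "k = (\<lambda>x. (h1 x)\<^sup>2)"
  define k1 where "k1 = (\<lambda>x. 2 * h1 x * h2 x)"
  have "continuous_on {u..v} k" unfolding k_def
    by (intro continuous_intros continuous_on_subset[OF neg_schwarzian_on_continuous[OF ns] X])
  then obtain w0 where w0: "w0 \<in> {u..v}" "\<And>y. y \<in> {u..v} \<Longrightarrow> k w0 \<le> k y"
    using continuous_attains_inf[of "{u..v}" k] s by fastforce
  have ks: "k s \<le> k u" "k s \<le> k v" unfolding k_def using le by (auto simp: abs_le_square_iff)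
  \<comment> \<open>If an endpoint is a minimiser, so is \<open>s\<close> by \<open>ks\<close>; thus
    an interior minimiser always exists.\<close>
  obtain w where w: "u < w" "w < v" "\<And>y. y \<in> {u..v} \<Longrightarrow> k w \<le> k y"
  proof (cases "w0 = u \<or> w0 = v")
    case True
    then show ?thesis using that[of s] w0(2) ks s by (metis order_trans)
  next
    case False
    then show ?thesis using that[of w0] w0 by auto
  qed
  have win: "w \<in> {u..v}" using w by auto
  have dk: "(k has_real_derivative k1 x) (at x)" if "x \<in> {u..v}" for x
    unfolding k_def k1_def using H[OF that] by (auto intro!: derivative_eq_intros)
  have k1w: "k1 w = 0"
    by (rule DERIV_local_min[OF dk[OF win], of "min (w - u) (v - w)"]) (use w in \<open>auto intro!: w(3)\<close>)
  then have h2w: "h2 w = 0" unfolding k1_def using H[OF win] by simp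
  have "(k1 has_real_derivative 2 * (h2 w * h2 w + h1 w * h3 w)) (at w)"
    unfolding k1_def
    by (rule derivative_eq_intros refl conjunct1[OF conjunct2[OF H[OF win]]]
          conjunct1[OF conjunct2[OF conjunct2[OF H[OF win]]]])+ (simp add: algebra_simps)
  \<comment> \<open>With \<open>h2 w = 0\<close> the Schwarzian inequality reduces to
    \<open>h1 w * h3 w < 0\<close>.\<close>
  moreover have "2 * (h2 w * h2 w + h1 w * h3 w) < 0" using H[OF win] h2w by simp
  ultimately obtain d where d: "d > 0" "\<And>t. 0 < t \<Longrightarrow> t < d \<Longrightarrow> k1 (w + t) < k1 w"
    using DERIV_neg_dec_right by blast
  obtain z where z: "w < z" "z < v" "z < w + d"
    using dense[of w "min v (w + d)"] d(1) w by auto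
  have "k z < k w"
  proof (rule DERIV_neg_imp_decreasing_open[OF z(1)])
    fix x assume x: "w < x" "x < z"
    have "k1 (w + (x - w)) < k1 w" using x z by (intro d(2)) auto
    then show "\<exists>y. (k has_real_derivative y) (at x) \<and> y < 0"
      using dk[of x] x z w k1w by auto
  next
    show "continuous_on {w..z} k"
      by (rule continuous_on_subset[OF \<open>continuous_on {u..v} k\<close>]) (use w z in auto)
  qed
  moreover have "k w \<le> k z" by (rule w(3)) (use w z in auto)
  ultimately show False by simp
qed

section \<open>Signs of derivatives, monotonicity and concavity\<close>

lemma nonzero_constant_sign:
  fixes h1 :: "real \<Rightarrow> real"
  assumes "continuous_on {al<..<be} h1" and "\<And>x. x \<in> {al<..<be} \<Longrightarrow> h1 x \<noteq> 0"
  shows "(\<forall>x\<in>{al<..<be}. h1 x > 0) \<or> (\<forall>x\<in>{al<..<be}. h1 x < 0)"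
proof (rule ccontr)
  assume "\<not> ?thesis"
  then obtain x y where xy: "x \<in> {al<..<be}" "y \<in> {al<..<be}" "h1 x < 0" "h1 y > 0"
    using assms(2) by (meson linorder_neqE_linordered_idom)
  have "connected (h1 ` {al<..<be})" by (intro connected_continuous_image assms) simp
  then have "0 \<in> h1 ` {al<..<be}"
    unfolding connected_iff_interval using xy by (metis imageI less_le)
  then show False using assms(2) by auto
qed

lemma neg_schwarzian_on_sign:
  assumes "neg_schwarzian_on h h1 {al<..<be}"
  shows "(\<forall>x\<in>{al<..<be}. h1 x > 0) \<or> (\<forall>x\<in>{al<..<be}. h1 x < 0)"
  by (intro nonzero_constant_sign neg_schwarzian_on_continuous[OF assms]
      neg_schwarzian_on_nonzero[OF assms])

lemma DERIV_pos_less: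
  assumes co: "continuous_on {al..be} h"
    and d: "\<And>x. x \<in> {al<..<be} \<Longrightarrow> (h has_real_derivative h1 x) (at x) \<and> h1 x > 0"
    and xy: "al \<le> x" "x < y" "y \<le> be"
  shows "h x < h y"
proof (rule DERIV_pos_imp_increasing_open[OF xy(2)])
  show "\<exists>D. (h has_real_derivative D) (at z) \<and> D > 0" if "x < z" "z < y" for z
    using d[of z] that xy by auto
  show "continuous_on {x..y} h"
    by (rule continuous_on_subset[OF co]) (use xy in auto)
qed

lemma DERIV_neg_less:
  assumes co: "continuous_on {al..be} h"
    and d: "\<And>x. x \<in> {al<..<be} \<Longrightarrow> (h has_real_derivative h1 x) (at x) \<and> h1 x < 0"
    and xy: "al \<le> x" "x < y" "y \<le> be"
  shows "h y < h x"
proof (rule DERIV_neg_imp_decreasing_open[OF xy(2)])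
  show "\<exists>D. (h has_real_derivative D) (at z) \<and> D < 0" if "x < z" "z < y" for z
    using d[of z] that xy by auto
  show "continuous_on {x..y} h"
    by (rule continuous_on_subset[OF co]) (use xy in auto)
qed

lemma mean_value:
  assumes "u < v" "continuous_on {u..v} h"
    and "\<And>x. x \<in> {u<..<v} \<Longrightarrow> (h has_real_derivative h1 x) (at x)"
  obtains w where "u < w" "w < v" "h v - h u = (v - u) * h1 w"
proof -
  have "\<exists>l z. u < z \<and> z < v \<and> (h has_real_derivative l) (at z) \<and> h v - h u = (v - u) * l"
    by (rule MVT[OF assms(1,2)])
       (use assms(3) in \<open>auto simp: real_differentiable_def\<close>)
  then obtain l z where z: "u < z" "z < v" "(h has_real_derivative l) (at z)"
    "h v - h u = (v - u) * l" by blast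
  then have "l = h1 z" using assms(3)[of z] DERIV_unique by auto
  with z that show ?thesis by blast
qed

text \<open>Adding the tangent inequalities of the convex function \<open>- h\<close> at the two
  points gives the comparison.\<close>

lemma concave_on_DERIV_antimono:
  assumes cv: "concave_on {u<..<v} h"
    and x: "u < x" "x < y" "y < v"
    and d: "(h has_real_derivative dx) (at x)" "(h has_real_derivative dy) (at y)"
  shows "dy \<le> dx"
proof -
  have c: "convex_on {u<..<v} (\<lambda>x. - h x)" using cv by (simp add: concave_on_def)
  have d': "((\<lambda>x. - h x) has_real_derivative - dx) (at x within {u<..<v})"
    "((\<lambda>x. - h x) has_real_derivative - dy) (at y within {u<..<v})"
    by (rule DERIV_minus[OF has_field_derivative_at_within[OF d(1)]],
        rule DERIV_minus[OF has_field_derivative_at_within[OF d(2)]])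
  have "(- h y) - (- h x) \<ge> (- dx) * (y - x)"
    by (rule convex_on_imp_above_tangent[OF c _ _ _ d'(1)]) (use x in auto)
  moreover have "(- h x) - (- h y) \<ge> (- dy) * (x - y)"
    by (rule convex_on_imp_above_tangent[OF c _ _ _ d'(2)]) (use x in auto)
  ultimately have "(dx - dy) * (y - x) \<ge> 0" by (simp add: algebra_simps)
  then show ?thesis using x by (simp add: zero_le_mult_iff)
qed

section \<open>Maps with a single turning point\<close>

text \<open>The product condition says that the derivative changes sign at \<open>m\<close> without
  fixing the direction, so peaks and valleys are treated together. The point \<open>m\<close> is
  left out of the Schwarzian condition because that condition requires a nonzero derivative.\<close>

definition folded_on ::
  "(real \<Rightarrow> real) \<Rightarrow> (real \<Rightarrow> real) \<Rightarrow> real \<Rightarrow> real \<Rightarrow> real \<Rightarrow> bool" where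
  "folded_on h h1 m al be \<longleftrightarrow>
     m \<in> {al<..<be} \<and> neg_schwarzian_on h h1 ({al<..<be} - {m}) \<and>
     (\<forall>x\<in>{al<..<m}. \<forall>y\<in>{m<..<be}. h1 x * h1 y < 0)"

text \<open>By the product condition, the sign at one sample point decides the signs on both sides.
  Strict monotonicity on the two closed halves then makes \<open>h m\<close> a strict extreme value,
  compared with the endpoints as well.\<close>

lemma folded_on_cases:
  assumes fo: "folded_on h h1 m al be" and co: "continuous_on {al..be} h"
  obtains
    (peak) "\<And>x. x \<in> {al<..<m} \<Longrightarrow> h1 x > 0" "\<And>x. x \<in> {m<..<be} \<Longrightarrow> h1 x < 0"
       "\<And>x. x \<in> {al..be} - {m} \<Longrightarrow> h x < h m"
  | (valley) "\<And>x. x \<in> {al<..<m} \<Longrightarrow> h1 x < 0" "\<And>x. x \<in> {m<..<be} \<Longrightarrow> h1 x > 0"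
       "\<And>x. x \<in> {al..be} - {m} \<Longrightarrow> h m < h x"
proof -
  have m: "al < m" "m < be" and ns: "neg_schwarzian_on h h1 ({al<..<be} - {m})"
    and sg: "\<And>x y. x \<in> {al<..<m} \<Longrightarrow> y \<in> {m<..<be} \<Longrightarrow> h1 x * h1 y < 0"
    using fo unfolding folded_on_def by auto
  have d: "(h has_real_derivative h1 x) (at x)" if "x \<in> {al<..<m} \<or> x \<in> {m<..<be}" for x
    using neg_schwarzian_on_DERIV[OF ns, of x] that m by auto
  have col: "continuous_on {al..m} h" and cor: "continuous_on {m..be} h"
    using m by (auto intro: continuous_on_subset[OF co])
  obtain x0 y0 where xy: "x0 \<in> {al<..<m}" "y0 \<in> {m<..<be}"
    using m dense by (metis greaterThanLessThan_iff)
  show ?thesis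
  proof (cases "h1 x0 > 0")
    case True
    have r: "h1 y < 0" if "y \<in> {m<..<be}" for y
      using sg[OF xy(1) that] True by (simp add: mult_less_0_iff)
    have l: "h1 x > 0" if "x \<in> {al<..<m}" for x
      using sg[OF that xy(2)] r[OF xy(2)] by (simp add: mult_less_0_iff)
    have "h x < h m" if "x \<in> {al..be} - {m}" for x
      using that DERIV_pos_less[OF col, of h1 x m] DERIV_neg_less[OF cor, of h1 m x] d l r
      by (cases "x < m") auto
    then show ?thesis using l r by (intro peak)
  next
    case False
    have r: "h1 y > 0" if "y \<in> {m<..<be}" for y
      using sg[OF xy(1) that] False by (simp add: mult_less_0_iff)
    have l: "h1 x < 0" if "x \<in> {al<..<m}" for x
      using sg[OF that xy(2)] r[OF xy(2)] by (simp add: mult_less_0_iff)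
    have "h m < h x" if "x \<in> {al..be} - {m}" for x
      using that DERIV_neg_less[OF col, of h1 x m] DERIV_pos_less[OF cor, of h1 m x] d l r
      by (cases "x < m") auto
    then show ?thesis using l r by (intro valley)
  qed
qed

lemma folded_on_reflect:
  assumes "folded_on h h1 m al be"
  shows "folded_on (\<lambda>x. - h (- x)) (\<lambda>x. h1 (- x)) (- m) (- be) (- al)"
proof -
  have "uminus ` ({al<..<be} - {m}) = {- be<..<- al} - {- m}"
    by (auto simp: image_set_diff)
  then have "neg_schwarzian_on (\<lambda>x. - h (- x)) (\<lambda>x. h1 (- x)) ({- be<..<- al} - {- m})"
    using neg_schwarzian_on_reflect[of h h1 "{al<..<be} - {m}"] assms
    unfolding folded_on_def by auto
  moreover have "h1 (- x) * h1 (- y) < 0" if "x \<in> {- be<..<- m}" "y \<in> {- m<..<- al}" for x y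
  proof -
    have "- y \<in> {al<..<m}" "- x \<in> {m<..<be}" using that by auto
    then show ?thesis using assms unfolding folded_on_def by (metis mult.commute)
  qed
  ultimately show ?thesis using assms unfolding folded_on_def by auto
qed

section \<open>Fixed points and endpoints of an invariant interval\<close>

text \<open>The mean value theorem gives a point with derivative 1 on each side of \<open>s\<close>,
  while the derivative at \<open>s\<close> has modulus at most 1; the minimum principle forbids
  this.\<close>

lemma no_attracting_point_between_fixed_points:
  assumes ns: "neg_schwarzian_on h h1 {al<..<be}" and co: "continuous_on {al..be} h"
    and s: "al < s" "s < be" and fx: "h al = al" "h s = s" "h be = be" and st: "\<bar>h1 s\<bar> \<le> 1"
  shows False
proof -
  have d: "(h has_real_derivative h1 x) (at x)" if "x \<in> {al<..<be}" for x
    using neg_schwarzian_on_DERIV[OF ns that] .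
  obtain u where u: "al < u" "u < s" "h s - h al = (s - al) * h1 u"
    using s by (elim mean_value[of al s h h1]) (auto intro: d continuous_on_subset[OF co])
  obtain v where v: "s < v" "v < be" "h be - h s = (be - s) * h1 v"
    using s by (elim mean_value[of s be h h1]) (auto intro: d continuous_on_subset[OF co])
  have "h1 u = 1" "h1 v = 1" using u v fx by auto
  then show False
    by (intro minimum_principle[OF ns, of u v s]) (use u v st in auto)
qed

text \<open>If the images differ, they are \<open>al\<close> and \<open>be\<close> in some order. A
  turning value would lie beyond both and hence outside the open interval. A monotone map fixes or
  exchanges the endpoints, so \<open>h\<close> or its second iterate has fixed points
  \<open>al\<close>, \<open>s\<close>, \<open>be\<close>. The hypothesis on derivatives at
  \<open>s\<close> is stated for every \<open>D\<close> because \<open>s\<close> may be the turning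
  point, where \<open>h1\<close> need not be the derivative.\<close>

lemma basin_endpoints_same_image:
  assumes reg: "neg_schwarzian_on h h1 {al<..<be} \<or> folded_on h h1 m al be"
    and co: "continuous_on {al..be} h" and inv: "h ` {al<..<be} \<subseteq> {al<..<be}"
    and s: "al < s" "s < be" "h s = s"
    and st: "\<And>D. (h has_real_derivative D) (at s) \<Longrightarrow> \<bar>D\<bar> \<le> 1"
    and ends: "h al \<in> {al, be}" "h be \<in> {al, be}"
  shows "h al = h be"
proof (rule ccontr)
  assume ne: "h al \<noteq> h be"
  from reg show False
  proof
    assume fo: "folded_on h h1 m al be"
    then have m: "m \<in> {al<..<be}" unfolding folded_on_def by auto
    with inv have hm: "h m \<in> {al<..<be}" by blast
    have "al \<in> {al..be} - {m}" "be \<in> {al..be} - {m}" using m by auto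
    with folded_on_cases[OF fo co] have "(h al < h m \<and> h be < h m) \<or> (h m < h al \<and> h m < h be)"
      by metis
    then show False using hm ends ne by auto
  next
    assume ns: "neg_schwarzian_on h h1 {al<..<be}"
    have d: "(h has_real_derivative h1 x) (at x)" if "x \<in> {al<..<be}" for x
      using neg_schwarzian_on_DERIV[OF ns that] .
    have h1s: "\<bar>h1 s\<bar> \<le> 1" using st[OF d] s by auto
    from neg_schwarzian_on_sign[OF ns] show False
    proof
      assume "\<forall>x\<in>{al<..<be}. h1 x > 0"
      then have "h al < h be" using DERIV_pos_less[OF co, of h1 al be] d s by auto
      then show False
        using no_attracting_point_between_fixed_points[OF ns co s(1,2) _ s(3) _ h1s] ends s by auto
    next
      assume "\<forall>x\<in>{al<..<be}. h1 x < 0"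
      then have "h be < h al" using DERIV_neg_less[OF co, of h1 al be] d s by auto
      \<comment> \<open>The endpoints form a 2-cycle, so that \<open>h \<circ> h\<close> has three fixed points.\<close>
      then have e: "h al = be" "h be = al" using ends s by auto
      have inv': "h ` {al..be} \<subseteq> {al..be}"
      proof
        fix y assume "y \<in> h ` {al..be}"
        then obtain x where x: "x \<in> {al..be}" "y = h x" by blast
        then consider "x = al" | "x = be" | "x \<in> {al<..<be}" by fastforce
        then show "y \<in> {al..be}" using x e inv s by cases (auto simp: image_subset_iff less_imp_le)
      qed
      \<comment> \<open>The derivative of the second iterate at \<open>s\<close> is
        \<open>h1 s * h1 s\<close>, again of modulus at most 1.\<close>
      show False
        by (rule no_attracting_point_between_fixed_points[OF
              neg_schwarzian_on_compose[OF ns ns inv]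
              continuous_on_compose2[OF co co inv'] s(1,2)])
           (use e s h1s mult_le_one[of "\<bar>h1 s\<bar>" "\<bar>h1 s\<bar>"] in \<open>auto simp: abs_mult\<close>)
    qed
  qed
qed

text \<open>Such a map must be a valley, since \<open>h m < be\<close>. Concavity at
  \<open>s\<close> makes the modulus of the derivative no smaller on the side of \<open>s\<close>
  towards \<open>m\<close>; a mean value on the other side supplies the second point for the minimum
  principle.\<close>

lemma valley_concave_distance:
  assumes fo: "folded_on h h1 m al be"
    and co: "continuous_on {al..be} h" and inv: "h ` {al<..<be} \<subseteq> {al<..<be}"
    and s: "al < s" "s < be" "h s = s"
    and st: "\<And>D. (h has_real_derivative D) (at s) \<Longrightarrow> \<bar>D\<bar> \<le> 1"
    and ends: "h al = be" "h be = be"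
    and cv: "concave_on {s - e<..<s + e} h" and e: "e > 0"
  shows "be - s \<le> s - al"
proof (rule ccontr)
  assume far: "\<not> ?thesis"
  have m: "al < m" "m < be" and ns: "neg_schwarzian_on h h1 ({al<..<be} - {m})"
    using fo unfolding folded_on_def by auto
  have hm: "h m \<in> {al<..<be}" using m inv by (auto simp: image_subset_iff)
  have d: "(h has_real_derivative h1 x) (at x)" if "x \<in> {al<..<be} - {m}" for x
    using neg_schwarzian_on_DERIV[OF ns that] .
  have anti: "h1 y \<le> h1 x" if "s - e < x" "x < y" "y < s + e"
      "x \<in> {al<..<be} - {m}" "y \<in> {al<..<be} - {m}" for x y
    using concave_on_DERIV_antimono[OF cv that(1,2,3) d d] that(4,5) by auto
  from fo co show False
  proof (cases rule: folded_on_cases)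
    case peak
    then have "h al < h m" using m by auto
    then show ?thesis using ends hm by auto
  next
    case valley
    consider "s = m" | "s < m" | "m < s" by linarith
    then show ?thesis
    proof cases
      case 1
      \<comment> \<open>Concavity at the midpoint of \<open>s - t\<close> and \<open>s + t\<close>
        contradicts the strict minimum at \<open>s = m\<close>.\<close>
      obtain t where t: "t > 0" "t < e" "t < s - al" "t < be - s"
        using dense[of 0 "min e (min (s - al) (be - s))"] e s by auto
      have v: "h m < h (s - t)" "h m < h (s + t)" using valley(3) t 1 by auto
      have c: "convex_on {s - e<..<s + e} (\<lambda>x. - h x)" using cv by (simp add: concave_on_def)
      have half: "1 - 1/2 = (1/2 :: real)" by simp
      have mid: "(1/2) *\<^sub>R (s - t) + (1/2) *\<^sub>R (s + t) = m"
        using 1 by (simp add: field_simps)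
      have "- h m \<le> (1/2) * (- h (s - t)) + (1/2) * (- h (s + t))"
        using convex_onD[OF c, of "1/2" "s - t" "s + t"] t unfolding half mid by simp
      with v show ?thesis by linarith
    next
      case 2
      \<comment> \<open>Since \<open>al\<close> is sent to \<open>be\<close>, the mean slope between
        \<open>al\<close> and \<open>s\<close> has modulus \<open>(be - s) / (s - al)\<close>, which
        exceeds 1 by \<open>far\<close>.\<close>
      obtain u where u: "al < u" "u < s" "h s - h al = (s - al) * h1 u"
        using s 2 by (elim mean_value[of al s h h1]) (auto intro: d continuous_on_subset[OF co])
      have "(s - al) * \<bar>h1 u\<bar> = be - s"
        using u(3) ends s valley(1)[of u] u 2 by (simp add: algebra_simps)
      then have hu: "\<bar>h1 u\<bar> > 1" using far s
        by (smt (verit) mult_left_le)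
      have h1s: "\<bar>h1 s\<bar> \<le> 1" using st[OF d] s 2 by auto
      obtain y where y: "s < y" "y < s + e" "y < m"
        using dense[of s "min (s + e) m"] e 2 by auto
      \<comment> \<open>The derivative is negative left of \<open>m\<close>, so its decrease is an
        increase of the modulus.\<close>
      have "h1 y \<le> h1 s" using anti[of s y] y s m e by auto
      moreover have "h1 s < 0" using valley(1)[of s] s 2 by auto
      ultimately have "\<bar>h1 s\<bar> \<le> \<bar>h1 y\<bar>" by auto
      then show ?thesis
        by (intro minimum_principle[OF ns, of u y s]) (use u y h1s hu m in auto)
    next
      case 3
      obtain v where v: "s < v" "v < be" "h be - h s = (be - s) * h1 v"
        using s 3 by (elim mean_value[of s be h h1]) (auto intro: d continuous_on_subset[OF co])
      have hv: "h1 v = 1" using v ends s by auto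
      have h1s: "\<bar>h1 s\<bar> \<le> 1" using st[OF d] s 3 by auto
      obtain y where y: "y < s" "s - e < y" "m < y"
        using dense[of "max (s - e) m" s] e 3 by auto
      have "h1 s \<le> h1 y" using anti[of y s] y s m e by auto
      moreover have "h1 s > 0" using valley(2)[of s] s 3 by auto
      ultimately have "\<bar>h1 s\<bar> \<le> \<bar>h1 y\<bar>" by auto
      then show ?thesis
        by (intro minimum_principle[OF ns, of y v s]) (use v y h1s hv m in auto)
    qed
  qed
qed

lemma convex_on_reflect:
  fixes h :: "real \<Rightarrow> real"
  assumes "convex_on {u<..<v} h"
  shows "concave_on {- v<..<- u} (\<lambda>x. - h (- x))"
proof -
  have "convex_on {- v<..<- u} (\<lambda>x. h (- x))"
  proof (rule convex_onI)
    fix t x y :: real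
    assume t: "0 < t" "t < 1" and x: "x \<in> {- v<..<- u}" and y: "y \<in> {- v<..<- u}"
    have "h ((1 - t) *\<^sub>R (- x) + t *\<^sub>R (- y)) \<le> (1 - t) * h (- x) + t * h (- y)"
      by (rule convex_onD[OF assms]) (use t x y in auto)
    then show "h (- ((1 - t) *\<^sub>R x + t *\<^sub>R y)) \<le> (1 - t) * h (- x) + t * h (- y)"
      by (simp add: algebra_simps)
  qed simp
  then show ?thesis by (simp add: concave_on_def)
qed

text \<open>Conjugation by x -> -x exchanges peak with valley, convex with concave and
  \<open>al\<close> with \<open>- be\<close>, which leads back to
  \<open>valley_concave_distance\<close>.\<close>

lemma peak_convex_distance:
  assumes fo: "folded_on h h1 m al be"
    and co: "continuous_on {al..be} h" and inv: "h ` {al<..<be} \<subseteq> {al<..<be}"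
    and s: "al < s" "s < be" "h s = s"
    and st: "\<And>D. (h has_real_derivative D) (at s) \<Longrightarrow> \<bar>D\<bar> \<le> 1"
    and ends: "h al = al" "h be = al"
    and cv: "convex_on {s - e<..<s + e} h" and e: "e > 0"
  shows "s - al \<le> be - s"
proof -
  have "- al - (- s) \<le> - s - (- be)"
  proof (rule valley_concave_distance[OF folded_on_reflect[OF fo]])
    show "continuous_on {- be..- al} (\<lambda>x. - h (- x))"
      by (intro continuous_intros continuous_on_compose2[OF co]) auto
    show "(\<lambda>x. - h (- x)) ` {- be<..<- al} \<subseteq> {- be<..<- al}"
      using inv by (auto simp: image_subset_iff)
    show "concave_on {- s - e<..<- s + e} (\<lambda>x. - h (- x))"
      proof -
      have "- (s + e) = - s - e" "- (s - e) = - s + e" by simp_all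
      then show ?thesis using convex_on_reflect[OF cv] by metis
    qed
    fix D assume "((\<lambda>x. - h (- x)) has_real_derivative D) (at (- s))"
    then have "((\<lambda>x. h (- x)) has_real_derivative - D) (at (- s))"
      using DERIV_minus by fastforce
    then have "(h has_real_derivative D) (at s)"
      using DERIV_mirror[of h D "- s"] by simp
    then show "\<bar>D\<bar> \<le> 1" by (rule st)
  qed (use s ends e in auto)
  then show ?thesis by simp
qed

text \<open>Both properties together would make the derivative constant beside \<open>s\<close>,
  against the minimum principle. The definition of the capture interval tests concavity first, so
  the convex case must exclude it.\<close>

lemma not_concave_and_convex:
  assumes reg: "neg_schwarzian_on h h1 {al<..<be} \<or> folded_on h h1 m al be"
    and s: "al < s" "s < be"
    and cc: "concave_on {s - e<..<s + e} h" and cv: "convex_on {s - e<..<s + e} h" and e: "e > 0"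
  shows False
proof -
  \<comment> \<open>A one-sided interval suffices and can be chosen to avoid the turning point, even
    when \<open>s = m\<close>.\<close>
  obtain v where v: "s < v" "v \<le> s + e" and ns: "neg_schwarzian_on h h1 {s<..<v}"
  proof (cases "neg_schwarzian_on h h1 {al<..<be}")
    case True
    show ?thesis
      by (rule that[of "min be (s + e)"]) (use s e in \<open>auto intro: neg_schwarzian_on_subset[OF True]\<close>)
  next
    case False
    then have ns: "neg_schwarzian_on h h1 ({al<..<be} - {m})"
      using reg unfolding folded_on_def by auto
    show ?thesis
    proof (cases "s < m")
      case True
      show ?thesis
        by (rule that[of "min (min m be) (s + e)"])
           (use s e True in \<open>auto intro: neg_schwarzian_on_subset[OF ns]\<close>)
    next
      case False
      show ?thesis
        by (rule that[of "min be (s + e)"])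
           (use s e False in \<open>auto intro: neg_schwarzian_on_subset[OF ns]\<close>)
    qed
  qed
  have const: "h1 x = h1 y" if "s < x" "x < y" "y < v" for x y
  proof -
    have d: "(h has_real_derivative h1 x) (at x)" "(h has_real_derivative h1 y) (at y)"
      using neg_schwarzian_on_DERIV[OF ns] that by auto
    have "h1 y \<le> h1 x"
      by (rule concave_on_DERIV_antimono[OF cc _ _ _ d]) (use that v in auto)
    moreover have "- h1 y \<le> - h1 x"
      by (rule concave_on_DERIV_antimono[where u = "s - e" and v = "s + e", OF _ _ _ _ DERIV_minus[OF d(1)] DERIV_minus[OF d(2)]])
         (use that v cv in \<open>auto simp: concave_on_def\<close>)
    ultimately show ?thesis by simp
  qed
  define t where "t = (v - s) / 4"
  have t: "t > 0" "v = s + 4 * t" using v unfolding t_def by (simp_all add: field_simps)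
  show False
    by (rule minimum_principle[OF ns, of "s + t" "s + 3 * t" "s + 2 * t"])
       (use t const[of "s + t" "s + 2 * t"] const[of "s + 2 * t" "s + 3 * t"] in auto)
qed

lemma neg_schwarzian_on_endpoints_noteq:
  assumes ns: "neg_schwarzian_on h h1 {al<..<be}" and co: "continuous_on {al..be} h"
    and xy: "x \<in> {al..be}" "y \<in> {al..be}" "x < y"
  shows "h x \<noteq> h y"
proof -
  have d: "(h has_real_derivative h1 x) (at x)" if "x \<in> {al<..<be}" for x
    using neg_schwarzian_on_DERIV[OF ns that] .
  show ?thesis
    using neg_schwarzian_on_sign[OF ns] DERIV_pos_less[OF co, of h1 x y]
      DERIV_neg_less[OF co, of h1 x y] d xy by fastforce
qed

section \<open>Turning points of compositions\<close>

text \<open>The outer derivative has constant sign on the image, so it multiplies the product of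
  slopes by a positive factor and creates no new turning point.\<close>

lemma folded_on_compose_outer:
  assumes f: "neg_schwarzian_on f f1 {u<..<v}" and h: "folded_on h h1 m al be"
    and sub: "h ` {al<..<be} \<subseteq> {u<..<v}"
  shows "folded_on (\<lambda>x. f (h x)) (\<lambda>x. f1 (h x) * h1 x) m al be"
proof -
  have m: "m \<in> {al<..<be}" and ns: "neg_schwarzian_on h h1 ({al<..<be} - {m})"
    and sg: "\<And>x y. x \<in> {al<..<m} \<Longrightarrow> y \<in> {m<..<be} \<Longrightarrow> h1 x * h1 y < 0"
    using h unfolding folded_on_def by auto
  have "(f1 (h x) * h1 x) * (f1 (h y) * h1 y) < 0" if "x \<in> {al<..<m}" "y \<in> {m<..<be}" for x y
  proof -
    have "h x \<in> {u<..<v}" "h y \<in> {u<..<v}" using sub that m by (auto simp: image_subset_iff)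
    then have "f1 (h x) * f1 (h y) > 0"
      using neg_schwarzian_on_sign[OF f] by (metis zero_less_mult_iff)
    then have "(f1 (h x) * f1 (h y)) * (h1 x * h1 y) < 0"
      using sg[OF that] by (rule mult_pos_neg)
    then show ?thesis by (simp add: mult_ac)
  qed
  moreover have "neg_schwarzian_on (\<lambda>x. f (h x)) (\<lambda>x. f1 (h x) * h1 x) ({al<..<be} - {m})"
    by (rule neg_schwarzian_on_compose[OF f ns]) (use sub in auto)
  ultimately show ?thesis using m unfolding folded_on_def by blast
qed

text \<open>The inner map is strictly monotone and takes the value \<open>c\<close> only at
  \<open>m\<close>; the fold of the outer map is therefore pulled back to \<open>m\<close>.\<close>

lemma folded_on_compose_inner:
  assumes f: "folded_on f f1 c a b" and h: "neg_schwarzian_on h h1 {al<..<be}"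
    and co: "continuous_on {al..be} h" and sub: "h ` {al<..<be} \<subseteq> {a<..<b}"
    and m: "m \<in> {al<..<be}" "h m = c"
  shows "folded_on (\<lambda>x. f (h x)) (\<lambda>x. f1 (h x) * h1 x) m al be"
proof -
  have d: "(h has_real_derivative h1 x) (at x)" if "x \<in> {al<..<be}" for x
    using neg_schwarzian_on_DERIV[OF h that] .
  have nf: "neg_schwarzian_on f f1 ({a<..<b} - {c})"
    and sg: "\<And>x y. x \<in> {a<..<c} \<Longrightarrow> y \<in> {c<..<b} \<Longrightarrow> f1 x * f1 y < 0"
    using f unfolding folded_on_def by auto
  have ne: "h x \<noteq> c" if "x \<in> {al<..<be} - {m}" for x
  proof -
    have "x < m \<or> m < x" using that by auto
    then show ?thesis
      using neg_schwarzian_on_endpoints_noteq[OF h co, of x m]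
        neg_schwarzian_on_endpoints_noteq[OF h co, of m x] that m by auto
  qed
  have "(f1 (h x) * h1 x) * (f1 (h y) * h1 y) < 0" if xy: "x \<in> {al<..<m}" "y \<in> {m<..<be}" for x y
  proof -
    have ab: "h x \<in> {a<..<b}" "h y \<in> {a<..<b}" using sub xy m by (auto simp: image_subset_iff)
    from neg_schwarzian_on_sign[OF h] show ?thesis
    proof
      assume p: "\<forall>x\<in>{al<..<be}. 0 < h1 x"
      then have "h x < c" "c < h y"
        using DERIV_pos_less[OF co, of h1 x m] DERIV_pos_less[OF co, of h1 m y] d xy m by auto
      then have "f1 (h x) * f1 (h y) < 0" using sg[of "h x" "h y"] ab by auto
      moreover have "h1 x * h1 y > 0" using p xy m by auto
      ultimately have "(f1 (h x) * f1 (h y)) * (h1 x * h1 y) < 0" by (rule mult_neg_pos)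
      then show ?thesis by (simp add: mult_ac)
    next
      assume p: "\<forall>x\<in>{al<..<be}. h1 x < 0"
      then have "c < h x" "h y < c"
        using DERIV_neg_less[OF co, of h1 x m] DERIV_neg_less[OF co, of h1 m y] d xy m by auto
      then have "f1 (h y) * f1 (h x) < 0" using sg[of "h y" "h x"] ab by auto
      moreover have "h1 x * h1 y > 0" using p xy m by (auto intro: mult_neg_neg)
      ultimately have "(f1 (h y) * f1 (h x)) * (h1 x * h1 y) < 0" by (rule mult_neg_pos)
      then show ?thesis by (simp add: mult_ac)
    qed
  qed
  moreover have "neg_schwarzian_on (\<lambda>x. f (h x)) (\<lambda>x. f1 (h x) * h1 x) ({al<..<be} - {m})"
    by (rule neg_schwarzian_on_compose[OF nf neg_schwarzian_on_subset[OF h]])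
       (use sub ne in \<open>auto simp: image_subset_iff\<close>)
  ultimately show ?thesis using m unfolding folded_on_def by blast
qed

section \<open>Stability of fixed points\<close>

text \<open>If the modulus exceeded 1, each step would stretch the distance to \<open>z\<close> by a
  factor \<open>L > 1\<close> as long as the orbit stays near \<open>z\<close>. Stability keeps it
  near forever, yet the distance grows like \<open>L ^ n\<close>.\<close>

lemma lyapunov_stable_multiplier:
  assumes ly: "lyapunov_stable I g z" and I: "z \<in> interior I" and fx: "g z = z"
    and D: "(g has_real_derivative D) (at z)"
  shows "\<bar>D\<bar> \<le> 1"
proof (rule ccontr)
  assume "\<not> ?thesis"
  \<comment> \<open>The midpoint lies strictly between 1 and the modulus of \<open>D\<close>,
    leaving room for the difference quotient to exceed \<open>L\<close>.\<close>
  define L where "L = (1 + \<bar>D\<bar>) / 2"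
  have L: "1 < L" "L < \<bar>D\<bar>" using \<open>\<not> \<bar>D\<bar> \<le> 1\<close> unfolding L_def by auto
  have "((\<lambda>y. \<bar>(g y - g z) / (y - z)\<bar>) \<longlongrightarrow> \<bar>D\<bar>) (at z)"
    using D unfolding has_field_derivative_iff by (rule tendsto_rabs)
  then have "\<forall>\<^sub>F y in at z. L < \<bar>(g y - g z) / (y - z)\<bar>"
    using L(2) by (rule order_tendstoD)
  then obtain e where e: "e > 0" "\<And>y. y \<noteq> z \<Longrightarrow> dist y z < e \<Longrightarrow> L < \<bar>(g y - g z) / (y - z)\<bar>"
    unfolding eventually_at by auto
  have ex: "L * \<bar>y - z\<bar> \<le> \<bar>g y - z\<bar>" if "y \<noteq> z" "dist y z < e" for y
    using e(2)[OF that] that(1) fx by (simp add: abs_divide field_simps)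
  obtain d where d: "d > 0" "\<And>x n. x \<in> I \<Longrightarrow> dist x z < d \<Longrightarrow> dist ((g ^^ n) x) z < e"
    using ly e(1) unfolding lyapunov_stable_def by blast
  obtain r where r: "r > 0" "ball z r \<subseteq> I"
    using I by (auto simp: mem_interior)
  define x where "x = z + min d r / 2"
  have x: "x \<noteq> z" "x \<in> I" "dist x z < d"
    using r d(1) by (auto simp: x_def dist_real_def intro!: subsetD[OF r(2)])
  have grow: "L ^ n * \<bar>x - z\<bar> \<le> \<bar>(g ^^ n) x - z\<bar>" for n
  proof (induction n)
    case (Suc n)
    have "0 < L ^ n * \<bar>x - z\<bar>" using x L by simp
    then have ne: "(g ^^ n) x \<noteq> z" using Suc by auto
    have "L ^ Suc n * \<bar>x - z\<bar> \<le> L * \<bar>(g ^^ n) x - z\<bar>" using Suc L by simp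
    also have "\<dots> \<le> \<bar>(g ^^ Suc n) x - z\<bar>" using ex[OF ne d(2)[OF x(2,3)]] by simp
    finally show ?case .
  qed simp
  obtain n where "e / \<bar>x - z\<bar> < L ^ n" using real_arch_pow[OF L(1)] by blast
  then have "e < L ^ n * \<bar>x - z\<bar>" using x by (simp add: field_simps)
  moreover have "L ^ n * \<bar>x - z\<bar> < e"
    using grow[of n] d(2)[OF x(2,3), of n] by (simp add: dist_real_def)
  ultimately show False by simp
qed

text \<open>Orbits starting close enough to a stable \<open>z\<close> stay within half the distance
  from \<open>z\<close> to \<open>s\<close>, so they cannot converge to a different
  \<open>s\<close>. This shows instability of fixed endpoints of a basin.\<close>

lemma lyapunov_stable_limit_unique:
  fixes z s :: real
  assumes ly: "lyapunov_stable I g z"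
    and near: "\<And>d. d > 0 \<Longrightarrow> \<exists>x\<in>I. dist x z < d \<and> (\<lambda>n. (g ^^ n) x) \<longlonglongrightarrow> s"
  shows "s = z"
proof (rule ccontr)
  assume "s \<noteq> z"
  then have e: "dist s z / 2 > 0" by simp
  then obtain d where d: "d > 0" "\<And>x n. x \<in> I \<Longrightarrow> dist x z < d \<Longrightarrow> dist ((g ^^ n) x) z < dist s z / 2"
    using ly unfolding lyapunov_stable_def by blast
  obtain x where x: "x \<in> I" "dist x z < d" "(\<lambda>n. (g ^^ n) x) \<longlonglongrightarrow> s"
    using near[OF d(1)] by blast
  have "(\<lambda>n. dist ((g ^^ n) x) z) \<longlonglongrightarrow> dist s z"
    by (intro tendsto_intros x)
  then have "dist s z \<le> dist s z / 2"
    by (rule LIMSEQ_le_const2) (use d(2)[OF x(1,2)] in \<open>auto intro: less_imp_le\<close>)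
  then show False using e by simp
qed

section \<open>Intervals, sorted lists and local concavity\<close>

lemma open_connected_real_interval:
  fixes T :: "real set"
  assumes "open T" "connected T" "T \<noteq> {}" "bounded T"
  shows "T = {Inf T<..<Sup T}"
proof
  have bd: "bdd_below T" "bdd_above T"
    using assms(4) by (auto intro: bounded_imp_bdd_below bounded_imp_bdd_above)
  show "T \<subseteq> {Inf T<..<Sup T}"
  proof
    fix x assume "x \<in> T"
    then obtain e where e: "e > 0" "ball x e \<subseteq> T" using assms(1) open_contains_ball by blast
    have "x - e/2 \<in> T" "x + e/2 \<in> T" using e by (auto intro!: subsetD[OF e(2)] simp: dist_real_def)
    then have "Inf T \<le> x - e/2" "x + e/2 \<le> Sup T" using bd by (auto intro: cInf_lower cSup_upper)
    then show "x \<in> {Inf T<..<Sup T}" using e(1) by auto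
  qed
  show "{Inf T<..<Sup T} \<subseteq> T"
  proof
    fix x assume "x \<in> {Inf T<..<Sup T}"
    then obtain y z where "y \<in> T" "y < x" "z \<in> T" "x < z"
      using assms(3) bd by (auto simp: cInf_less_iff less_cSup_iff)
    then show "x \<in> T" using assms(2) unfolding connected_iff_interval by (meson less_imp_le)
  qed
qed

lemma nth_sorted_list_of_set_cover:
  fixes A :: "'a::linorder set"
  assumes A: "finite A" "u \<in> A" "v \<in> A" "u < v" and x: "u \<le> x" "x \<le> v"
  obtains j where "j < length (sorted_list_of_set A) - 1"
    "sorted_list_of_set A ! j \<le> x" "x \<le> sorted_list_of_set A ! Suc j"
proof -
  define l where "l = sorted_list_of_set A"
  have l: "set l = A" "sorted l" using A unfolding l_def by auto
  obtain i k where i: "i < length l" "l ! i = u" and k: "k < length l" "l ! k = v"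
    using A l by (metis in_set_conv_nth)
  have ik: "i < k" using sorted_nth_mono[OF l(2), of k i] i k A(4) by (meson leD linorder_not_less)
  \<comment> \<open>The bound \<open>j < k\<close> keeps \<open>Suc j\<close> a valid index; if the
    maximal \<open>j\<close> has \<open>Suc j = k\<close>, the next entry is \<open>v\<close>, which
    bounds \<open>x\<close>.\<close>
  define J where "J = {j. j < k \<and> l ! j \<le> x}"
  have J: "finite J" "i \<in> J" unfolding J_def using ik i x by auto
  define j where "j = Max J"
  have jJ: "j \<in> J" unfolding j_def using J by (auto intro: Max_in)
  have "x \<le> l ! Suc j"
  proof (cases "Suc j = k")
    case False
    then have "Suc j \<notin> J" using Max_ge[OF J(1), of "Suc j"] unfolding j_def by fastforce
    then show ?thesis using jJ False unfolding J_def by auto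
  qed (use k x in auto)
  then show ?thesis
    using that[of j] jJ k unfolding J_def l_def by auto
qed

text \<open>At an interior point the neighbourhood relative to \<open>I\<close> contains a full
  symmetric interval. All smaller radii are included so that two such radii can be replaced by their
  minimum.\<close>

lemma concave_near_interval:
  assumes "concave_near I g s" "s \<in> interior I"
  obtains e where "e > 0" "\<And>d. d \<le> e \<Longrightarrow> concave_on {s - d<..<s + d} g"
proof -
  obtain e where e: "e > 0" "concave_on (I \<inter> ball s e) g"
    using assms(1) unfolding concave_near_def by blast
  obtain r where r: "r > 0" "ball s r \<subseteq> I" using assms(2) by (auto simp: mem_interior)
  have "concave_on {s - d<..<s + d} g" if "d \<le> min e r" for d
  proof -
    have "{s - d<..<s + d} \<subseteq> I \<inter> ball s e"
      using that by (auto simp: dist_real_def intro!: subsetD[OF r(2)])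
    then show ?thesis using e(2) unfolding concave_on_def by (meson convex_on_subset convex_real_interval(8))
  qed
  then show ?thesis using that[of "min e r"] e(1) r(1) by auto
qed

lemma convex_near_interval:
  assumes "convex_near I g s" "s \<in> interior I"
  obtains e where "e > 0" "\<And>d. d \<le> e \<Longrightarrow> convex_on {s - d<..<s + d} g"
proof -
  have "concave_near I (\<lambda>x. - g x) s"
    using assms(1) unfolding convex_near_def concave_near_def concave_on_def by simp
  then obtain e where "e > 0" "\<And>d. d \<le> e \<Longrightarrow> concave_on {s - d<..<s + d} (\<lambda>x. - g x)"
    using concave_near_interval[OF _ assms(2)] by blast
  then show ?thesis using that by (simp add: concave_on_def)
qed

section \<open>Immediate basins\<close>

text \<open>One parameter value is fixed here, \<open>f\<close> standing for that member of the
  family. The assumption \<open>orientation\<close> ties the side on which \<open>U i\<close> lies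
  to the shape of the graph at \<open>S i\<close>.\<close>

locale attracting_cycle =
  fixes a b c :: real and f :: "real \<Rightarrow> real" and p :: nat and S U X' :: "nat \<Rightarrow> real"
  assumes unimodal: "unimodal_neg_schwarzian a b c f"
    and stable: "stable_periodic_orbit {a..b} f p S"
    and nearest: "\<And>i. i < p \<Longrightarrow> nearest_unstable_fixed_point {a..b} (f ^^ p) (S i) (U i)"
    and orientation: "\<And>i. i < p \<Longrightarrow> (concave_near {a..b} (f ^^ p) (S i) \<and> U i < S i) \<or>
                       (convex_near {a..b} (f ^^ p) (S i) \<and> S i < U i)"
    and opposite: "\<And>i. i < p \<Longrightarrow> opposite_point {a..b} (f ^^ p) (S i) (U i) (X' i)"
begin

section \<open>The map, its iterates and the orbit\<close>

lemma critical_point: "a < c" "c < b"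
  using unimodal unfolding unimodal_neg_schwarzian_def by auto

lemma iterate_in: "x \<in> {a..b} \<Longrightarrow> (f ^^ n) x \<in> {a..b}"
proof (induction n)
  case (Suc n)
  then show ?case using unimodal unfolding unimodal_neg_schwarzian_def by auto
qed simp

lemma continuous_on_iterate: "continuous_on {a..b} (f ^^ n)"
proof (induction n)
  case (Suc n)
  have "continuous_on {a..b} f" using unimodal unfolding unimodal_neg_schwarzian_def by auto
  then have "continuous_on {a..b} (\<lambda>x. f ((f ^^ n) x))"
    by (rule continuous_on_compose2[OF _ Suc]) (use iterate_in in blast)
  then show ?case by (simp add: o_def)
qed (simp add: id_def)

lemma mono_branches: "strict_mono_on {a..c} f" "strict_antimono_on {c..b} f"
  using unimodal unfolding unimodal_neg_schwarzian_def by auto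

lemma neg_schwarzian_on_f: "neg_schwarzian_on f (deriv f) ({a<..<b} - {c})"
proof -
  have "(f has_real_derivative deriv f x) (at x) \<and>
      (deriv f has_real_derivative (deriv ^^ 2) f x) (at x) \<and>
      ((deriv ^^ 2) f has_real_derivative (deriv ^^ 3) f x) (at x) \<and> deriv f x \<noteq> 0 \<and>
      2 * deriv f x * (deriv ^^ 3) f x < 3 * ((deriv ^^ 2) f x)\<^sup>2" if x: "x \<in> {a<..<b} - {c}" for x
  proof -
    have df: "(deriv ^^ k) f field_differentiable (at x)" if "k < 3" for k
      using unimodal x that unfolding unimodal_neg_schwarzian_def by auto
    have nz: "deriv f x \<noteq> 0" and sc: "schwarzian f x < 0"
      using unimodal x unfolding unimodal_neg_schwarzian_def by auto
    have "(deriv f x)\<^sup>2 * (2 * schwarzian f x)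
        = 2 * deriv f x * (deriv ^^ 3) f x - 3 * ((deriv ^^ 2) f x)\<^sup>2"
      unfolding schwarzian_def using nz by (simp add: field_simps power2_eq_square)
    moreover have "(deriv f x)\<^sup>2 * (2 * schwarzian f x) < 0"
      using nz sc by (intro mult_pos_neg) auto
    ultimately show ?thesis
      using nz df[of 0] df[of 1] df[of 2]
      by (auto simp: field_differentiable_derivI numeral_2_eq_2 numeral_3_eq_3
          DERIV_deriv_iff_field_differentiable[symmetric])
  qed
  then show ?thesis unfolding neg_schwarzian_on_def
    by (intro exI[of _ "(deriv ^^ 2) f"] exI[of _ "(deriv ^^ 3) f"] ballI)
qed

text \<open>The derivative has constant sign on each branch; comparing the values at the ends of the
  branch decides which sign.\<close>

lemma folded_on_f: "folded_on f (deriv f) c a b"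
proof -
  have co: "continuous_on {a..b} f" using continuous_on_iterate[of 1] by simp
  have d: "(f has_real_derivative deriv f x) (at x)" if "x \<in> {a<..<b} - {c}" for x
    using neg_schwarzian_on_DERIV[OF neg_schwarzian_on_f that] .
  have l: "neg_schwarzian_on f (deriv f) {a<..<c}" and r: "neg_schwarzian_on f (deriv f) {c<..<b}"
    using critical_point by (auto intro!: neg_schwarzian_on_subset[OF neg_schwarzian_on_f])
  have col: "continuous_on {a..c} f" and cor: "continuous_on {c..b} f"
    using critical_point by (auto intro: continuous_on_subset[OF co])
  have "f a < f c" "f b < f c"
    using mono_branches critical_point by (auto simp: monotone_on_def)
  have pos: "\<forall>x\<in>{a<..<c}. deriv f x > 0"
  proof (rule ccontr)
    assume "\<not> ?thesis"
    then have "\<forall>x\<in>{a<..<c}. deriv f x < 0" using neg_schwarzian_on_sign[OF l] by blast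
    then have "f c < f a"
      by (intro DERIV_neg_less[OF col, of "deriv f" a c]) (use d critical_point in auto)
    then show False using \<open>f a < f c\<close> by simp
  qed
  have neg: "\<forall>x\<in>{c<..<b}. deriv f x < 0"
  proof (rule ccontr)
    assume "\<not> ?thesis"
    then have "\<forall>x\<in>{c<..<b}. deriv f x > 0" using neg_schwarzian_on_sign[OF r] by blast
    then have "f c < f b"
      by (intro DERIV_pos_less[OF cor, of "deriv f" c b]) (use d critical_point in auto)
    then show False using \<open>f b < f c\<close> by simp
  qed
  show ?thesis
    unfolding folded_on_def
    using critical_point neg_schwarzian_on_f pos neg by (auto intro: mult_pos_neg)
qed

text \<open>On each branch \<open>f x\<close> lies strictly between an endpoint value, at least
  \<open>a\<close>, and \<open>f c\<close>, at most \<open>b\<close>. The point \<open>c\<close> is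
  excluded because \<open>f c = b\<close> is possible.\<close>

lemma f_interior: "x \<in> {a<..<b} - {c} \<Longrightarrow> f x \<in> {a<..<b}"
proof -
  assume x: "x \<in> {a<..<b} - {c}"
  have "f a \<ge> a" "f b \<ge> a" "f c \<le> b"
    using iterate_in[of a 1] iterate_in[of b 1] iterate_in[of c 1] critical_point by auto
  moreover have "x < c \<Longrightarrow> f a < f x \<and> f x < f c" "c < x \<Longrightarrow> f b < f x \<and> f x < f c"
    using mono_branches critical_point x by (auto simp: monotone_on_def)
  moreover have "x < c \<or> c < x" using x by auto
  ultimately show ?thesis by auto
qed

lemma orbit:
  assumes "i < p"
  shows "S i \<in> {a..b}" "f (S i) = S (Suc i mod p)" "(f ^^ p) (S i) = S i"
    "stable_fixed_point {a..b} (f ^^ p) (S i)"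
  using stable assms
  unfolding stable_periodic_orbit_def periodic_orbit_def stable_fixed_point_def by auto

lemma period_pos: "p > 0"
  using stable unfolding stable_periodic_orbit_def periodic_orbit_def by auto

lemma orbit_inj: "i < p \<Longrightarrow> j < p \<Longrightarrow> S i = S j \<Longrightarrow> i = j"
  using stable unfolding stable_periodic_orbit_def periodic_orbit_def inj_on_def by auto

section \<open>Basins and their components around the orbit\<close>

text \<open>Convergence is taken along \<open>f ^^ p\<close>, so that every point of the orbit has
  its own basin and distinct basins are disjoint.\<close>

definition basin :: "nat \<Rightarrow> real set" where
  "basin i = {x \<in> {a..b}. (\<lambda>n. ((f ^^ p) ^^ n) x) \<longlonglongrightarrow> S i}"

definition immediate_basin :: "nat \<Rightarrow> real set" where
  "immediate_basin i = connected_component_set (basin i) (S i)"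

lemma fixed_point_iterate: "g z = z \<Longrightarrow> (g ^^ n) z = z"
  by (induction n) auto

lemma orbit_in_basin: "i < p \<Longrightarrow> S i \<in> basin i"
  using orbit[of i] fixed_point_iterate[of "f ^^ p" "S i"] by (simp add: basin_def)

lemma f_basin:
  assumes i: "i < p" and x: "x \<in> basin i"
  shows "f x \<in> basin (Suc i mod p)"
proof -
  have xi: "x \<in> {a..b}" and lim: "(\<lambda>n. ((f ^^ p) ^^ n) x) \<longlonglongrightarrow> S i"
    using x unfolding basin_def by auto
  have eq: "((f ^^ p) ^^ n) (f x) = f (((f ^^ p) ^^ n) x)" for n
    by (simp add: funpow_mult funpow_swap1)
  have co: "continuous_on {a..b} f" using continuous_on_iterate[of 1] by simp
  have "(\<lambda>n. f (((f ^^ p) ^^ n) x)) \<longlonglongrightarrow> f (S i)"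
    by (rule continuous_on_tendsto_compose[OF co lim orbit(1)[OF i]])
       (use iterate_in[OF xi] in \<open>simp add: funpow_mult\<close>)
  then show ?thesis
    using orbit(2)[OF i] iterate_in[OF xi, of 1] by (simp add: basin_def eq)
qed

text \<open>Dropping the first term of a sequence does not change its limit. The equivalence also
  keeps points outside the basin outside.\<close>

lemma iterate_basin_iff:
  assumes "x \<in> {a..b}"
  shows "(f ^^ p) x \<in> basin i \<longleftrightarrow> x \<in> basin i"
proof -
  have "(\<lambda>n. ((f ^^ p) ^^ n) ((f ^^ p) x)) = (\<lambda>n. ((f ^^ p) ^^ Suc n) x)"
    by (simp add: funpow_Suc_right del: funpow.simps)
  then show ?thesis
    using assms iterate_in[OF assms, of p]
      filterlim_sequentially_Suc[of "\<lambda>n. ((f ^^ p) ^^ n) x" "nhds (S i)"]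
    by (simp add: basin_def del: funpow.simps)
qed

text \<open>Some iterate of \<open>x\<close> enters the neighbourhood attracted to
  \<open>S i\<close>; by continuity of that iterate nearby points enter it too.\<close>

lemma basin_open:
  assumes i: "i < p" and x: "x \<in> basin i"
  obtains e where "e > 0" "{a..b} \<inter> ball x e \<subseteq> basin i"
proof -
  have xi: "x \<in> {a..b}" and lim: "(\<lambda>n. ((f ^^ p) ^^ n) x) \<longlonglongrightarrow> S i"
    using x unfolding basin_def by auto
  obtain d where d: "d > 0"
    "\<And>x. x \<in> {a..b} \<Longrightarrow> dist x (S i) < d \<Longrightarrow> (\<lambda>n. ((f ^^ p) ^^ n) x) \<longlonglongrightarrow> S i"
    using orbit(4)[OF i] unfolding stable_fixed_point_def by blast
  obtain N where N: "dist (((f ^^ p) ^^ N) x) (S i) < d"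
    using tendstoD[OF lim d(1)] by (auto simp: eventually_sequentially)
  have "continuous_on {a..b} ((f ^^ p) ^^ N)"
    using continuous_on_iterate by (simp add: funpow_mult)
  then obtain e where e: "e > 0" "\<And>y. y \<in> {a..b} \<Longrightarrow> dist y x < e \<Longrightarrow>
      dist (((f ^^ p) ^^ N) y) (((f ^^ p) ^^ N) x) < d - dist (((f ^^ p) ^^ N) x) (S i)"
    using xi N unfolding continuous_on_iff by (metis diff_gt_0_iff_gt)
  have "y \<in> basin i" if y: "y \<in> {a..b}" "dist y x < e" for y
  proof -
    have "dist (((f ^^ p) ^^ N) y) (S i) < d"
      using e(2)[OF y] dist_triangle[of "((f ^^ p) ^^ N) y" "S i" "((f ^^ p) ^^ N) x"] by simp
    moreover have "((f ^^ p) ^^ N) y \<in> {a..b}"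
      using iterate_in[OF y(1)] by (simp add: funpow_mult)
    ultimately have "(\<lambda>n. ((f ^^ p) ^^ n) (((f ^^ p) ^^ N) y)) \<longlonglongrightarrow> S i" by (intro d(2))
    then have "(\<lambda>n. ((f ^^ p) ^^ (n + N)) y) \<longlonglongrightarrow> S i" by (simp add: funpow_add)
    then have "(\<lambda>n. ((f ^^ p) ^^ n) y) \<longlonglongrightarrow> S i" by (rule LIMSEQ_offset)
    then show ?thesis using y(1) by (simp add: basin_def)
  qed
  then have "{a..b} \<inter> ball x e \<subseteq> basin i" by (auto simp: dist_commute)
  with e(1) show ?thesis by (rule that)
qed

lemma immediate_basin_subset: "immediate_basin i \<subseteq> basin i"
  and connected_immediate_basin: "connected (immediate_basin i)"
  unfolding immediate_basin_def by (simp_all add: connected_component_subset)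

lemma orbit_in_immediate_basin: "i < p \<Longrightarrow> S i \<in> immediate_basin i"
  unfolding immediate_basin_def using orbit_in_basin by simp

lemma immediate_basin_maximal:
  "x \<in> T \<Longrightarrow> x \<in> immediate_basin i \<Longrightarrow> connected T \<Longrightarrow> T \<subseteq> basin i \<Longrightarrow> T \<subseteq> immediate_basin i"
  unfolding immediate_basin_def
  by (metis connected_component_eq connected_component_maximal)

lemma f_immediate_basin:
  assumes i: "i < p" and x: "x \<in> immediate_basin i"
  shows "f x \<in> immediate_basin (Suc i mod p)"
proof -
  have j: "Suc i mod p < p" using period_pos by simp
  have "f ` immediate_basin i \<subseteq> immediate_basin (Suc i mod p)"
  proof (rule immediate_basin_maximal[OF _ orbit_in_immediate_basin[OF j]])
    show "S (Suc i mod p) \<in> f ` immediate_basin i"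
      using orbit(2)[OF i] orbit_in_immediate_basin[OF i] by force
    have "immediate_basin i \<subseteq> {a..b}"
      using immediate_basin_subset[of i] by (auto simp: basin_def)
    then have "continuous_on (immediate_basin i) f"
      using continuous_on_iterate[of 1] by (simp add: continuous_on_subset)
    then show "connected (f ` immediate_basin i)"
      using connected_immediate_basin by (rule connected_continuous_image)
    show "f ` immediate_basin i \<subseteq> basin (Suc i mod p)"
      using f_basin[OF i] immediate_basin_subset by blast
  qed
  with x show ?thesis by blast
qed

lemma iterate_immediate_basin:
  assumes i: "i < p" and x: "x \<in> immediate_basin i"
  shows "(f ^^ k) x \<in> immediate_basin ((i + k) mod p)"
proof (induction k)
  case (Suc k)
  have "(i + k) mod p < p" using period_pos by simp
  from f_immediate_basin[OF this Suc] show ?case by (simp add: mod_Suc_eq)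
qed (use i x in simp)

lemma immediate_basin_disjoint:
  assumes "i < p" "j < p" "x \<in> immediate_basin i" "x \<in> immediate_basin j"
  shows "i = j"
  using assms immediate_basin_subset[of i] immediate_basin_subset[of j] orbit_inj[of i j] LIMSEQ_unique
  unfolding basin_def by blast

text \<open>\<open>U i\<close> is a fixed point other than \<open>S i\<close>, and
  \<open>X' i\<close> is mapped to it, so neither is in the basin. A connected set around
  \<open>S i\<close> cannot pass them.\<close>

lemma immediate_basin_bounds:
  assumes i: "i < p" and x: "x \<in> immediate_basin i"
  shows "(U i < S i \<longrightarrow> U i < x \<and> x < X' i) \<and> (S i < U i \<longrightarrow> X' i < x \<and> x < U i)"
proof -
  have u: "U i \<in> {a..b}" "(f ^^ p) (U i) = U i"
    using nearest[OF i] unfolding nearest_unstable_fixed_point_def unstable_fixed_point_def by auto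
  have x': "X' i \<in> {a..b}" "S i \<in> open_segment (U i) (X' i)" "(f ^^ p) (X' i) = U i"
    using opposite[OF i] unfolding opposite_point_def by auto
  have ne: "U i \<noteq> S i" using orientation[OF i] by auto
  have U: "U i \<notin> basin i"
  proof
    assume "U i \<in> basin i"
    then have "(\<lambda>n. U i) \<longlonglongrightarrow> S i"
      using fixed_point_iterate[of "f ^^ p" "U i"] u unfolding basin_def by simp
    then show False using ne by (simp add: LIMSEQ_const_iff)
  qed
  moreover have X: "X' i \<notin> basin i"
    using iterate_basin_iff[OF x'(1), of i] U x'(3) by simp
  ultimately have nin: "U i \<notin> immediate_basin i" "X' i \<notin> immediate_basin i"
    using immediate_basin_subset by auto
  have mid: "z \<in> immediate_basin i" if "(x \<le> z \<and> z \<le> S i) \<or> (S i \<le> z \<and> z \<le> x)" for z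
    using connected_immediate_basin[of i] orbit_in_immediate_basin[OF i] x that
    unfolding connected_iff_interval by blast
  show ?thesis
    using nin mid[of "U i"] mid[of "X' i"] x'(2)
    by (simp add: open_segment_eq_real_ivl split: if_splits) (meson not_le)+
qed

text \<open>Avoiding \<open>a\<close> and \<open>b\<close> turns relative openness into openness and
  keeps the basin where \<open>f\<close> has derivatives.\<close>

lemma immediate_basin_interior: "i < p \<Longrightarrow> immediate_basin i \<subseteq> {a<..<b}"
proof
  fix x assume i: "i < p" and x: "x \<in> immediate_basin i"
  have "U i \<in> {a..b}" "X' i \<in> {a..b}"
    using nearest[OF i] opposite[OF i]
    unfolding nearest_unstable_fixed_point_def unstable_fixed_point_def opposite_point_def by auto
  then show "x \<in> {a<..<b}"
    using immediate_basin_bounds[OF i x] orientation[OF i] by auto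
qed

lemma open_immediate_basin:
  assumes i: "i < p"
  shows "open (immediate_basin i)"
  unfolding open_contains_ball
proof
  fix x assume x: "x \<in> immediate_basin i"
  then have "x \<in> basin i" "x \<in> {a<..<b}"
    using immediate_basin_subset immediate_basin_interior[OF i] by auto
  then obtain e d where e: "e > 0" "{a..b} \<inter> ball x e \<subseteq> basin i" "d > 0" "ball x d \<subseteq> {a<..<b}"
    using basin_open[OF i] open_contains_ball[of "{a<..<b}"] by (metis open_greaterThanLessThan)
  have "ball x (min e d) \<subseteq> immediate_basin i"
  proof (rule immediate_basin_maximal[OF _ x])
    have "ball x (min e d) \<subseteq> {a<..<b}" "ball x (min e d) \<subseteq> ball x e" using e(4) by auto
    then show "ball x (min e d) \<subseteq> basin i" using e(2) by fastforce
  qed (use e in auto)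
  then show "\<exists>e>0. ball x e \<subseteq> immediate_basin i" using e by (intro exI[of _ "min e d"]) auto
qed

lemma immediate_basin_interval:
  assumes i: "i < p"
  obtains al be where "immediate_basin i = {al<..<be}" "al < S i" "S i < be"
    "al \<in> {a..b}" "be \<in> {a..b}"
    "U i < S i \<Longrightarrow> U i \<le> al \<and> be \<le> X' i" "S i < U i \<Longrightarrow> X' i \<le> al \<and> be \<le> U i"
proof -
  define al where "al = Inf (immediate_basin i)"
  define be where "be = Sup (immediate_basin i)"
  have "bounded (immediate_basin i)"
    by (rule bounded_subset[OF _ immediate_basin_interior[OF i]]) simp
  then have eq: "immediate_basin i = {al<..<be}"
    using open_connected_real_interval[OF open_immediate_basin[OF i] connected_immediate_basin]
      orbit_in_immediate_basin[OF i] unfolding al_def be_def by auto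
  have s: "al < S i" "S i < be" using orbit_in_immediate_basin[OF i] unfolding eq by auto
  have lo: "l \<le> al" if "\<And>x. x \<in> immediate_basin i \<Longrightarrow> l < x" for l
    unfolding al_def using that orbit_in_immediate_basin[OF i] by (intro cInf_greatest) (auto intro: less_imp_le)
  have hi: "be \<le> u" if "\<And>x. x \<in> immediate_basin i \<Longrightarrow> x < u" for u
    unfolding be_def using that orbit_in_immediate_basin[OF i] by (intro cSup_least) (auto intro: less_imp_le)
  have "a \<le> al" "be \<le> b"
    using immediate_basin_interior[OF i] by (auto intro!: lo hi)
  show ?thesis
  proof (rule that[OF eq s])
    show "al \<in> {a..b}" "be \<in> {a..b}" using \<open>a \<le> al\<close> \<open>be \<le> b\<close> s by auto
    show "U i \<le> al \<and> be \<le> X' i" if "U i < S i"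
      using immediate_basin_bounds[OF i] that by (intro conjI lo hi) auto
    show "X' i \<le> al \<and> be \<le> U i" if "S i < U i"
      using immediate_basin_bounds[OF i] that by (intro conjI lo hi) auto
  qed
qed

section \<open>Shape of the return map and identification of the basin\<close>

text \<open>A turning point arises only when an image of the basin meets \<open>c\<close>. The
  images along one period lie in different immediate basins, so this happens at most once; the
  witness \<open>j\<close> records when. The induction starts at \<open>f\<close>, since the
  identity has Schwarzian derivative zero.\<close>

lemma iterate_regular_or_folded:
  assumes i: "i < p" and eq: "immediate_basin i = {al<..<be}" and ab: "al \<in> {a..b}" "be \<in> {a..b}"
    and k: "Suc k \<le> p"
  shows "\<exists>h1. neg_schwarzian_on (f ^^ Suc k) h1 {al<..<be} \<or>
    (\<exists>m j. j \<le> k \<and> m \<in> {al<..<be} \<and> (f ^^ j) m = c \<and> folded_on (f ^^ Suc k) h1 m al be)"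
  using k
proof (induction k)
  case 0
  have sub: "{al<..<be} \<subseteq> {a<..<b}" using ab by auto
  show ?case
  proof (cases "c \<in> {al<..<be}")
    case True
    have "folded_on f (deriv f) c al be"
      using folded_on_f True sub ab unfolding folded_on_def
      by (auto intro: neg_schwarzian_on_subset)
    then show ?thesis using True by (intro exI[of _ "deriv f"] disjI2 exI[of _ c] exI[of _ 0]) simp
  next
    case False
    have "neg_schwarzian_on f (deriv f) {al<..<be}"
      by (rule neg_schwarzian_on_subset[OF neg_schwarzian_on_f]) (use sub False in auto)
    then show ?thesis by auto
  qed
next
  case (Suc k)
  let ?h = "f ^^ Suc k"
  have Sf: "f ^^ Suc (Suc k) = (\<lambda>x. f (?h x))" by (simp add: o_def)
  have co: "continuous_on {al..be} ?h"
    by (rule continuous_on_subset[OF continuous_on_iterate]) (use ab in auto)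
  define l where "l = (i + Suc k) mod p"
  have l: "l < p" using period_pos by (simp add: l_def)
  have img: "?h ` {al<..<be} \<subseteq> immediate_basin l"
    using iterate_immediate_basin[OF i] unfolding l_def eq by blast
  obtain u v where uv: "immediate_basin l = {u<..<v}"
    using immediate_basin_interval[OF l] by metis
  from Suc obtain h1 where "neg_schwarzian_on ?h h1 {al<..<be} \<or>
    (\<exists>m j. j \<le> k \<and> m \<in> {al<..<be} \<and> (f ^^ j) m = c \<and> folded_on ?h h1 m al be)"
    by (meson Suc_leD)
  then show ?case
  proof (elim disjE exE conjE)
    assume ns: "neg_schwarzian_on ?h h1 {al<..<be}"
    show ?thesis
    proof (cases "c \<in> ?h ` {al<..<be}")
      case True
      then obtain m where m: "m \<in> {al<..<be}" "?h m = c" by blast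
      have "folded_on (\<lambda>x. f (?h x)) (\<lambda>x. deriv f (?h x) * h1 x) m al be"
        by (rule folded_on_compose_inner[OF folded_on_f ns co _ m])
           (use img immediate_basin_interior[OF l] in blast)
      then show ?thesis using m unfolding Sf by blast
    next
      case False
      have "neg_schwarzian_on (\<lambda>x. f (?h x)) (\<lambda>x. deriv f (?h x) * h1 x) {al<..<be}"
        by (rule neg_schwarzian_on_compose[OF neg_schwarzian_on_f ns])
           (use img immediate_basin_interior[OF l] False in blast)
      then show ?thesis unfolding Sf by blast
    qed
  next
    fix m j assume j: "j \<le> k" and m: "m \<in> {al<..<be}" "(f ^^ j) m = c"
      and fo: "folded_on ?h h1 m al be"
    \<comment> \<open>The basin component containing \<open>c\<close> is met only once along a period.\<close>
    have "c \<in> immediate_basin ((i + j) mod p)"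
      using iterate_immediate_basin[OF i, of m j] m unfolding eq by simp
    moreover have "(i + j) mod p \<noteq> l"
    proof
      assume "(i + j) mod p = l"
      \<comment> \<open>The difference \<open>Suc k - j\<close> is positive and smaller than
        \<open>p\<close>, hence not a multiple of \<open>p\<close>.\<close>
      then have "p dvd (i + Suc k) - (i + j)"
        using j unfolding l_def by (metis add_le_cancel_left le_SucI mod_eq_dvd_iff_nat)
      then have "p \<le> Suc k - j" using j by (intro dvd_imp_le) auto
      then show False using Suc.prems by simp
    qed
    ultimately have "c \<notin> immediate_basin l"
      using immediate_basin_disjoint[OF _ l] period_pos by (metis mod_less_divisor)
    then have "neg_schwarzian_on f (deriv f) {u<..<v}"
      using immediate_basin_interior[OF l] unfolding uv
      by (intro neg_schwarzian_on_subset[OF neg_schwarzian_on_f]) auto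
    then have "folded_on (\<lambda>x. f (?h x)) (\<lambda>x. deriv f (?h x) * h1 x) m al be"
      by (rule folded_on_compose_outer[OF _ fo]) (use img uv in simp)
    then show ?thesis using le_SucI[OF j] m unfolding Sf by blast
  qed
qed

lemma immediate_basin_eq_capture_interval:
  assumes i: "i < p"
  shows "immediate_basin i = capture_interval_at {a..b} f p S U X' i"
proof -
  let ?g = "f ^^ p"
  obtain al be where eq: "immediate_basin i = {al<..<be}" and s: "al < S i" "S i < be"
    and ab: "al \<in> {a..b}" "be \<in> {a..b}"
    and left: "U i < S i \<Longrightarrow> U i \<le> al \<and> be \<le> X' i"
    and right: "S i < U i \<Longrightarrow> X' i \<le> al \<and> be \<le> U i"
    using immediate_basin_interval[OF i] by metis
  have sint: "S i \<in> interior {a..b}" using s ab by (simp add: interior_atLeastAtMost_real)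
  have gs: "?g (S i) = S i" using orbit(3)[OF i] .
  have co: "continuous_on {al..be} ?g"
    by (rule continuous_on_subset[OF continuous_on_iterate]) (use ab in auto)
  have inv: "?g ` {al<..<be} \<subseteq> {al<..<be}"
  proof
    fix y assume "y \<in> ?g ` {al<..<be}"
    then obtain x where "x \<in> immediate_basin i" "y = ?g x" unfolding eq by blast
    then show "y \<in> {al<..<be}"
      using iterate_immediate_basin[OF i, of x p] i unfolding eq[symmetric] by simp
  qed
  have st: "\<bar>D\<bar> \<le> 1" if "(?g has_real_derivative D) (at (S i))" for D
    using lyapunov_stable_multiplier[OF _ sint gs that] orbit(4)[OF i]
    unfolding stable_fixed_point_def by blast
  obtain h1 m where reg: "neg_schwarzian_on ?g h1 {al<..<be} \<or> folded_on ?g h1 m al be"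
    using iterate_regular_or_folded[OF i eq ab, of "p - 1"] period_pos by auto
  \<comment> \<open>An endpoint in the basin could be added to the component, against its
    maximality.\<close>
  have notin: "z \<notin> basin i" if "z = al \<or> z = be" for z
  proof
    assume z: "z \<in> basin i"
    have "insert z {al<..<be} \<subseteq> immediate_basin i"
    proof (rule immediate_basin_maximal[OF _ orbit_in_immediate_basin[OF i]])
      show "connected (insert z {al<..<be})"
        unfolding connected_iff_interval using that s by auto
    qed (use s z immediate_basin_subset[of i] eq in auto)
    then show False using that unfolding eq by auto
  qed
  have gcl: "?g ` {al..be} \<subseteq> {al..be}"
  proof -
    have "closure {al<..<be} = {al..be}" using s by simp
    then show ?thesis
      using image_closure_subset[of "{al<..<be}" ?g "{al..be}"] co inv by fastforce
  qed
  \<comment> \<open>Continuity keeps the image in the closed interval, and a point outside the basin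
    cannot be mapped into it.\<close>
  have ends: "?g z \<in> {al, be}" if "z = al \<or> z = be" for z
  proof -
    have z: "z \<in> {al..be}" "z \<in> {a..b}" using that s ab by auto
    have "?g z \<notin> basin i" using iterate_basin_iff[OF z(2)] notin[OF that] by simp
    then have "?g z \<notin> {al<..<be}" using immediate_basin_subset[of i] unfolding eq by blast
    moreover have "?g z \<in> {al..be}" using gcl z(1) by blast
    ultimately show ?thesis by auto
  qed
  have same: "?g al = ?g be"
    by (rule basin_endpoints_same_image[OF reg co inv s gs st]) (use ends in auto)
  then have fo: "folded_on ?g h1 m al be"
    using reg neg_schwarzian_on_endpoints_noteq[OF _ co, of h1 al be] s by auto
  \<comment> \<open>A fixed endpoint is a limit of points attracted to \<open>S i\<close>, so it is
    unstable and competes with \<open>U i\<close> for being nearest.\<close>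
  have far: "dist (U i) (S i) \<le> dist z (S i)" if z: "z = al \<or> z = be" "?g z = z" for z
  proof -
    have "\<not> lyapunov_stable {a..b} ?g z"
    proof
      assume "lyapunov_stable {a..b} ?g z"
      then have "S i = z"
      proof (rule lyapunov_stable_limit_unique)
        fix d :: real assume d: "d > 0"
        have "\<exists>x\<in>{al<..<be}. dist x z < d"
        proof (cases "z = al")
          case True
          obtain x where "al < x" "x < min be (al + d)" using dense[of al "min be (al + d)"] d s by auto
          then show ?thesis using True by (intro bexI[of _ x]) (auto simp: dist_real_def)
        next
          case False
          obtain x where "max al (be - d) < x" "x < be" using dense[of "max al (be - d)" be] d s by auto
          then show ?thesis using False z by (intro bexI[of _ x]) (auto simp: dist_real_def)
        qed
        then show "\<exists>x\<in>{a..b}. dist x z < d \<and> (\<lambda>n. (?g ^^ n) x) \<longlonglongrightarrow> S i"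
          using immediate_basin_subset[of i] unfolding eq basin_def by blast
      qed
      then show False using z(1) s by auto
    qed
    moreover have "z \<in> {a..b}" using z(1) ab by auto
    ultimately show ?thesis
      using nearest[OF i] z(2)
      unfolding nearest_unstable_fixed_point_def unstable_fixed_point_def by blast
  qed
  have gU: "?g (U i) = U i"
    using nearest[OF i] unfolding nearest_unstable_fixed_point_def unstable_fixed_point_def by blast
  have opp: "dist (X' i) (S i) \<le> dist y (S i)"
    if "y \<in> {a..b}" "S i \<in> open_segment (U i) y" "?g y = U i" for y
    using opposite[OF i] that unfolding opposite_point_def by blast
  show ?thesis
    using orientation[OF i]
  proof (elim disjE conjE)
    assume cc: "concave_near {a..b} ?g (S i)" and U: "U i < S i"
    obtain e where e: "e > 0" "\<And>d. d \<le> e \<Longrightarrow> concave_on {S i - d<..<S i + d} ?g"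
      using concave_near_interval[OF cc sint] by blast
    have be: "be \<le> X' i" and al: "U i \<le> al" using left[OF U] by auto
    \<comment> \<open>Otherwise \<open>be\<close> is a fixed point no farther from
      \<open>S i\<close> than \<open>al\<close>. Since \<open>U i\<close> is nearest and not right
      of \<open>al\<close>, all these distances agree and \<open>al = U i\<close>, which is fixed, a
      contradiction.\<close>
    have "?g al \<noteq> be"
    proof
      assume g: "?g al = be"
      have "be - S i \<le> S i - al"
        by (rule valley_concave_distance[OF fo co inv s gs st g _ e(2) e(1)]) (use g same in auto)
      moreover have "S i - U i \<le> be - S i"
        using far[of be] g same s U by (auto simp: dist_real_def)
      ultimately have "al = U i" using al by simp
      then show False using g gU s by simp
    qed
    then have g: "?g al = al" using ends[of al] by auto
    have alU: "al = U i" using far[of al] g s U al by (auto simp: dist_real_def)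
    \<comment> \<open>By \<open>same\<close> the endpoint \<open>be\<close> also has image
      \<open>U i\<close>, so it is a candidate for the opposite point.\<close>
    have "dist (X' i) (S i) \<le> dist be (S i)"
      by (rule opp) (use ab s U same g alU in \<open>auto simp: open_segment_eq_real_ivl\<close>)
    then have "be = X' i" using be s by (auto simp: dist_real_def)
    then show ?thesis using alU cc eq by (simp add: capture_interval_at_def)
  next
    assume cv: "convex_near {a..b} ?g (S i)" and U: "S i < U i"
    obtain e where e: "e > 0" "\<And>d. d \<le> e \<Longrightarrow> convex_on {S i - d<..<S i + d} ?g"
      using convex_near_interval[OF cv sint] by blast
    have al: "X' i \<le> al" and be: "be \<le> U i" using right[OF U] by auto
    have "?g be \<noteq> al"
    proof
      assume g: "?g be = al"
      have "S i - al \<le> be - S i"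
        by (rule peak_convex_distance[OF fo co inv s gs st _ g e(2) e(1)]) (use g same in auto)
      moreover have "U i - S i \<le> S i - al"
        using far[of al] g same s U by (auto simp: dist_real_def)
      ultimately have "be = U i" using be by simp
      then show False using g gU s by simp
    qed
    then have g: "?g be = be" using ends[of be] by auto
    have beU: "be = U i" using far[of be] g s U be by (auto simp: dist_real_def)
    have "dist (X' i) (S i) \<le> dist al (S i)"
      by (rule opp) (use ab s U same g beU in \<open>auto simp: open_segment_eq_real_ivl\<close>)
    then have "al = X' i" using al s by (auto simp: dist_real_def)
    moreover have "\<not> concave_near {a..b} ?g (S i)"
    proof
      assume "concave_near {a..b} ?g (S i)"
      then obtain e' where e': "e' > 0" "\<And>d. d \<le> e' \<Longrightarrow> concave_on {S i - d<..<S i + d} ?g"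
        using concave_near_interval[OF _ sint] by blast
      show False
        by (rule not_concave_and_convex[OF reg s e'(2) e(2), of "min e e'"]) (use e e' in auto)
    qed
    ultimately show ?thesis using beU eq by (simp add: capture_interval_at_def)
  qed
qed

section \<open>Capture within \<open>q\<close> iterations\<close>

lemma capture_interval_eq_basins: "capture_interval {a..b} f p S U X' = (\<Union>i<p. immediate_basin i)"
  unfolding capture_interval_def using immediate_basin_eq_capture_interval by simp

lemma iterate_capture_interval:
  assumes "x \<in> capture_interval {a..b} f p S U X'"
  shows "(f ^^ k) x \<in> capture_interval {a..b} f p S U X'"
  using assms iterate_immediate_basin period_pos unfolding capture_interval_eq_basins
  by (metis UN_E UN_I lessThan_iff mod_less_divisor)

lemma open_capture_interval: "open (capture_interval {a..b} f p S U X')"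
  unfolding capture_interval_eq_basins using open_immediate_basin by auto

section \<open>Partition into intervals of monotonicity\<close>

text \<open>Each of the two branches of \<open>f\<close> is injective, so preimages of finite sets
  are finite. The induction splits off the first application of \<open>f\<close>.\<close>

lemma finite_iterate_preimage: "finite {x \<in> {a..b}. (f ^^ k) x = y}"
proof (induction k)
  case 0
  show ?case by (rule finite_subset[of _ "{y}"]) auto
next
  case (Suc k)
  let ?F = "{z \<in> {a..b}. (f ^^ k) z = y}"
  have "inj_on f {a..c}" using mono_branches(1) by (rule strict_mono_on_imp_inj_on)
  moreover have "inj_on f {c..b}"
    by (rule linorder_inj_onI') (use monotone_onD[OF mono_branches(2)] in fastforce)
  ultimately have "finite ((f -` ?F \<inter> {a..c}) \<union> (f -` ?F \<inter> {c..b}))"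
    using Suc by (intro finite_UnI finite_vimage_IntI)
  moreover have "{x \<in> {a..b}. (f ^^ Suc k) x = y} \<subseteq> (f -` ?F \<inter> {a..c}) \<union> (f -` ?F \<inter> {c..b})"
  proof
    fix x assume "x \<in> {x \<in> {a..b}. (f ^^ Suc k) x = y}"
    then have "x \<in> {a..b}" "(f ^^ k) (f x) = y" by (simp_all add: funpow_swap1)
    then show "x \<in> (f -` ?F \<inter> {a..c}) \<union> (f -` ?F \<inter> {c..b})"
      using iterate_in[of x 1] by auto
  qed
  ultimately show ?case by (rule finite_subset[rotated])
qed

text \<open>By the chain rule the derivative is a product of nonzero factors while the orbit avoids
  \<open>c\<close>. The orbit must also stay in the open interval, so this is carried through the
  induction.\<close>

lemma iterate_DERIV_nonzero:
  assumes x: "x \<in> {a<..<b}"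
  shows "(\<And>j. j < k \<Longrightarrow> (f ^^ j) x \<noteq> c) \<Longrightarrow>
    (f ^^ k) x \<in> {a<..<b} \<and> (\<exists>D. D \<noteq> 0 \<and> ((f ^^ k) has_real_derivative D) (at x))"
proof (induction k)
  case 0
  then show ?case using x by (auto intro!: exI[of _ 1] simp: id_def)
next
  case (Suc k)
  then obtain D where D: "D \<noteq> 0" "((f ^^ k) has_real_derivative D) (at x)"
    and y: "(f ^^ k) x \<in> {a<..<b} - {c}" by auto
  have "((\<lambda>x. f ((f ^^ k) x)) has_real_derivative deriv f ((f ^^ k) x) * D) (at x)"
    by (rule DERIV_chain2[OF neg_schwarzian_on_DERIV[OF neg_schwarzian_on_f y] D(2)])
  then show ?case
    using f_interior[OF y] D(1) neg_schwarzian_on_nonzero[OF neg_schwarzian_on_f y]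
    by (auto simp: o_def intro!: exI[of _ "deriv f ((f ^^ k) x) * D"])
qed

text \<open>At an extremum the derivative vanishes, so an earlier iterate hits \<open>c\<close>.
  Finiteness matters because \<open>sorted_list_of_set\<close> returns the empty list on an infinite
  set.\<close>

lemma finite_extremum_points: "finite (extremum_points a b (f ^^ q))"
proof (rule finite_subset)
  show "finite (\<Union>j<q. {x \<in> {a..b}. (f ^^ j) x = c})" using finite_iterate_preimage by blast
  show "extremum_points a b (f ^^ q) \<subseteq> (\<Union>j<q. {x \<in> {a..b}. (f ^^ j) x = c})"
  proof
    fix x assume "x \<in> extremum_points a b (f ^^ q)"
    then have x: "x \<in> {a<..<b}"
      and ex: "(\<forall>\<^sub>F y in at x. (f ^^ q) y \<le> (f ^^ q) x) \<or> (\<forall>\<^sub>F y in at x. (f ^^ q) x \<le> (f ^^ q) y)"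
      unfolding extremum_points_def by auto
    show "x \<in> (\<Union>j<q. {x \<in> {a..b}. (f ^^ j) x = c})"
    proof (rule ccontr)
      assume "\<not> ?thesis"
      then have "\<And>j. j < q \<Longrightarrow> (f ^^ j) x \<noteq> c" using x by auto
      then obtain D where D: "D \<noteq> 0" "((f ^^ q) has_real_derivative D) (at x)"
        using iterate_DERIV_nonzero[OF x] by blast
      from ex have "D = 0"
      proof
        assume "\<forall>\<^sub>F y in at x. (f ^^ q) y \<le> (f ^^ q) x"
        then obtain d where d: "d > 0" "\<And>y. y \<noteq> x \<Longrightarrow> dist y x < d \<Longrightarrow> (f ^^ q) y \<le> (f ^^ q) x"
          unfolding eventually_at by auto
        have "\<And>y. \<bar>x - y\<bar> < d \<Longrightarrow> y = x \<or> dist y x < d" by (auto simp: dist_real_def)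
        with d(2) show "D = 0"
          by (intro DERIV_local_max[OF D(2) d(1)]) fastforce
      next
        assume "\<forall>\<^sub>F y in at x. (f ^^ q) x \<le> (f ^^ q) y"
        then obtain d where d: "d > 0" "\<And>y. y \<noteq> x \<Longrightarrow> dist y x < d \<Longrightarrow> (f ^^ q) x \<le> (f ^^ q) y"
          unfolding eventually_at by auto
        have "\<And>y. \<bar>x - y\<bar> < d \<Longrightarrow> y = x \<or> dist y x < d" by (auto simp: dist_real_def)
        with d(2) show "D = 0"
          by (intro DERIV_local_min[OF D(2) d(1)]) fastforce
      qed
      with D(1) show False by simp
    qed
  qed
qed

text \<open>Consecutive partition points bound intervals that cover \<open>{a..b}\<close>; their
  shared endpoints do no harm in a union.\<close>

lemma q_capture_interval_eq:
  "q_capture_interval a b f p S U X' q =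
     {x \<in> {a..b}. (f ^^ q) x \<in> capture_interval {a..b} f p S U X'}"
proof -
  define A where "A = {a, b} \<union> extremum_points a b (f ^^ q)"
  define l where "l = partition_points a b (f ^^ q)"
  have l: "l = sorted_list_of_set A" unfolding l_def A_def partition_points_def ..
  have A: "finite A" "a \<in> A" "b \<in> A" "A \<subseteq> {a..b}"
    using finite_extremum_points critical_point unfolding A_def extremum_points_def by auto
  have "monotonicity_interval a b (f ^^ q) j \<subseteq> {a..b}" if "j < length l - 1" for j
  proof -
    have "l ! j \<in> set l" "l ! Suc j \<in> set l" using that by (auto intro!: nth_mem)
    then have "l ! j \<in> A" "l ! Suc j \<in> A" using A(1) by (simp_all add: l)
    then show ?thesis using A(4) unfolding monotonicity_interval_def l_def[symmetric] by auto
  qed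
  moreover have "\<exists>j<length l - 1. x \<in> monotonicity_interval a b (f ^^ q) j" if x: "x \<in> {a..b}" for x
  proof -
    have "a < b" using critical_point by simp
    then obtain j where "j < length l - 1" "l ! j \<le> x" "x \<le> l ! Suc j"
      using nth_sorted_list_of_set_cover[OF A(1-3), of x] x unfolding l by auto
    then show ?thesis unfolding monotonicity_interval_def l_def[symmetric] by auto
  qed
  ultimately have "(\<Union>j<length l - 1. monotonicity_interval a b (f ^^ q) j) = {a..b}" by blast
  moreover have "q_capture_interval a b f p S U X' q =
      {x \<in> \<Union>j<length l - 1. monotonicity_interval a b (f ^^ q) j.
        (f ^^ q) x \<in> capture_interval {a..b} f p S U X'}"
    unfolding q_capture_interval_def q_capture_interval_at_def capture_interval_def l_def by auto
  ultimately show ?thesis by simp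
qed

text \<open>Capture is permanent, so capture at some time up to \<open>q\<close> is the same as
  being in the capture interval at time \<open>q\<close>.\<close>

lemma capture_event_eq:
  "{x \<in> {a..b}. \<exists>l\<le>q. (f ^^ l) x \<in> capture_interval {a..b} f p S U X'} =
     q_capture_interval a b f p S U X' q"
proof -
  have "(f ^^ q) x \<in> capture_interval {a..b} f p S U X'"
    if "l \<le> q" "(f ^^ l) x \<in> capture_interval {a..b} f p S U X'" for l x
  proof -
    have "(f ^^ q) x = (f ^^ (q - l)) ((f ^^ l) x)"
      using that(1) by (metis comp_apply funpow_add le_add_diff_inverse2)
    then show ?thesis using iterate_capture_interval[OF that(2)] by simp
  qed
  then show ?thesis unfolding q_capture_interval_eq by blast
qed

text \<open>The set is the preimage of an open set. Measurability passes through the restricted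
  space since \<open>f ^^ q\<close> is known to be continuous only on \<open>{a..b}\<close>.\<close>

lemma q_capture_interval_borel: "q_capture_interval a b f p S U X' q \<in> sets borel"
proof -
  have "f ^^ q \<in> borel_measurable (restrict_space borel {a..b})"
    by (rule borel_measurable_continuous_on_restrict[OF continuous_on_iterate])
  then have "(f ^^ q) -` capture_interval {a..b} f p S U X' \<inter> {a..b} \<in> sets (restrict_space borel {a..b})"
    using measurable_sets[OF _ borel_open[OF open_capture_interval],
        of "f ^^ q" "restrict_space borel {a..b}"]
    by (simp add: space_restrict_space)
  moreover have "(f ^^ q) -` capture_interval {a..b} f p S U X' \<inter> {a..b} = q_capture_interval a b f p S U X' q"
    unfolding q_capture_interval_eq by auto
  ultimately show ?thesis by (simp add: sets_restrict_space_iff)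
qed

end

section \<open>Uniform probability on the interval\<close>

text \<open>The restricted measure agrees with \<open>lborel\<close> on subsets of
  \<open>{a..b}\<close>, so the normalised measure becomes a quotient of Lebesgue measures on the
  line.\<close>

lemma prob_uniform_on_interval:
  assumes "a < b" and E: "{x \<in> {a..b}. P x} \<in> sets borel"
  shows "\<P>(x in uniform_on_interval a b. P x) =
    measure lborel {x \<in> {a..b}. P x} / measure lborel {a..b}"
proof -
  let ?M = "restrict_space lborel {a..b}" and ?E = "{x \<in> {a..b}. P x}"
  have sp: "space (uniform_on_interval a b) = {a..b}"
    by (simp add: uniform_on_interval_def space_restrict_space)
  have Es: "?E \<in> sets ?M"
    using E by (auto simp: sets_restrict_space image_iff intro!: bexI[of _ ?E])
  have Is: "{a..b} \<in> sets ?M" by (auto simp: sets_restrict_space image_iff intro!: bexI[of _ "{a..b}"])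
  have em: "emeasure ?M A = emeasure lborel A" if "A \<subseteq> {a..b}" for A
    by (rule emeasure_restrict_space) (use that in auto)
  have "measure (uniform_on_interval a b) ?E = measure ?M ({a..b} \<inter> ?E) / measure ?M {a..b}"
    unfolding uniform_on_interval_def
    by (rule measure_uniform_measure) (use Es em[of "{a..b}"] assms(1) in auto)
  also have "{a..b} \<inter> ?E = ?E" by auto
  finally show ?thesis
    using em[OF subsetI, of ?E] em[of "{a..b}"] by (simp add: sp measure_def)
qed

theorem theorem1:
  fixes a b r :: real and R :: "real set"
    and f :: "real \<Rightarrow> real \<Rightarrow> real" and C :: "real \<Rightarrow> real"
    and p q :: nat and S U X' :: "nat \<Rightarrow> real"
  assumes "a < b"
    and "r \<in> R"
    and "\<And>s. s \<in> R \<Longrightarrow> unimodal_neg_schwarzian a b (C s) (f s)"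
    and "stable_periodic_orbit {a..b} (f r) p S"
    and "saddle_node_origin {a..b} f R r p S U \<or> period_doubling_origin {a..b} f R r p S U"
    and "\<And>i. i < p \<Longrightarrow> nearest_unstable_fixed_point {a..b} (f r ^^ p) (S i) (U i)"
    and "\<And>i. i < p \<Longrightarrow> (concave_near {a..b} (f r ^^ p) (S i) \<and> U i < S i) \<or>
                       (convex_near {a..b} (f r ^^ p) (S i) \<and> S i < U i)"
    and "\<And>i. i < p \<Longrightarrow> opposite_point {a..b} (f r ^^ p) (S i) (U i) (X' i)"
    and "q > 0"
  shows "\<P>(x in uniform_on_interval a b. \<exists>l\<le>q. (f r ^^ l) x \<in> capture_interval {a..b} (f r) p S U X')
           = measure lborel (q_capture_interval a b (f r) p S U X' q) / measure lborel {a..b} \<and>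
         measure lborel (q_capture_interval a b (f r) p S U X' q) / measure lborel {a..b}
           = measure lborel (q_capture_interval a b (f r) p S U X' q) / (b - a)"
proof -
  interpret attracting_cycle a b "C r" "f r" p S U X'
    by (rule attracting_cycle.intro[OF assms(3)[OF assms(2)] assms(4,6,7,8)])
  show ?thesis
    using prob_uniform_on_interval[OF \<open>a < b\<close>,
        of "\<lambda>x. \<exists>l\<le>q. (f r ^^ l) x \<in> capture_interval {a..b} (f r) p S U X'"]
      q_capture_interval_borel \<open>a < b\<close>
    unfolding capture_event_eq by simp
qed

end
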